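(* Let $\nu:k\to S$ be a valued field (a field $k$ with a valuation $\nu$), with $S$ a totally ordered idempotent semifield. Given a closed subscheme $Z\subset\mathbb{P}^n_k$, the tropicalization $\operatorname{Trop}^\nu_{\mathbb{P}^n}(Z)\subset\mathbb{P}^n_S$ has a well-defined Hilbert polynomial (its Hilbert function agrees with a polynomial in all sufficiently large degrees), and it coincides with the Hilbert polynomial of $Z$.
   Context: All semirings are commutative with unit. $S$ is idempotent if $a+a=a$; then $a\le b\iff a+b=b$ is a partial order, and $S$ is totally ordered if this is a total order. A semifield is a semiring in which every nonzero element is invertible. A valuation on a ring $R$ with values in an idempotent semiring $S$ is a map $\nu:R\to S$ with $\nu(0)=0_S$, $\nu(1)=\nu(-1)=1_S$, $\nu(ab)=\nu(a)\nu(b)$, $\nu(a+b)+\nu(a)+\nu(b)=\nu(a)+\nu(b)$. For $f\in S[x_0,\dots,x_n]$ and a monomial $m\in\operatorname{supp}(f)$, $f_{\widehat m}$ is $f$ with its $m$-term deleted; the bend relations of $f$ are $f\sim f_{\widehat m}$, $m\in\operatorname{supp}(f)$. An $S$-module congruence on a module $M$ is an equivalence relation that is a submodule of $M\times M$; a semiring congruence is an equivalence relation that is a subsemiring. For an $S$-submodule $J$, $\mathcal{B}(J)$ is the $S$-module congruence generated by the bend relations of all elements of $J$. For an ideal $I\subset k[x_0,\dots,x_n]$, $\operatorname{trop}(I)\subset S[x_0,\dots,x_n]$ is the $S$-submodule generated by the coefficient-wise valuations $\nu(f)$, $f\in I$; it is an ideal and $\mathcal{B}(\operatorname{trop}(I))$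 is a semiring congruence. Semiring schemes, $\operatorname{Proj}$ and closed subschemes (given locally by semiring congruences, i.e. by affine morphisms with surjective structure sheaf map) are defined as in ordinary scheme theory. A congruence $K$ on $S[x_0,\dots,x_n]$ is homogeneous if the grading descends to the quotient; then $\operatorname{Proj}(S[x_0,\dots,x_n]/K)$ is a closed subscheme of $\mathbb{P}^n_S$, and two homogeneous congruences define the same closed subscheme iff they coincide in all sufficiently large degrees. If $Z\subset\mathbb{P}^n_k$ is defined by a homogeneous ideal $I$, then $\operatorname{Trop}^\nu_{\mathbb{P}^n}(Z)=\operatorname{Proj}\big(S[x_0,\dots,x_n]/\mathcal{B}(\operatorname{trop}(I))\big)$. Dimension: for an $S$-module $L$ ($S$ a totally ordered semifield), $v_1,\dots,v_r\in L$ are linearly dependent if any linear combination of the $v_i$ can be written as a linear combination of a proper subset of the $v_i$; otherwise linearly independent. $\dim_S L$ is the largest size of a linearly independent set. $V^\vee=\operatorname{Hom}_S(V,S)$. The Hilbert function of a homogeneous congruence $K$ is $d\mapsto\dim_S\big((S[x_0,\dots,x_n]/K)_d\big)^\vee$. The saturation of $K$ is the maximal homogeneous congruence agreeing with $K$ in sufficiently high degrees; $K$ is saturated if it equals its saturation. The Hilbert function of a closed subscheme of $\mathbb{P}^n_S$ is that of the unique saturated homogeneous congruence defining it, and the Hilbert polynomial is the polynomial agreeing with it for $d\gg0$, if one exists.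
   Formalization: A closed subscheme of tropical projective space may have no saturated homogeneous congruence defining it; in that case its Hilbert function is taken from an arbitrary homogeneous congruence defining it, which agrees with any other such choice in all large degrees. *)

theory Defs
  imports
    "HOL-Library.Poly_Mapping"
    "HOL-Library.Extended_Nat"
    "HOL-Computational_Algebra.Polynomial"
    Complex_Main
begin

subsection \<open>Semirings and valuations\<close>

class idempotent_semiring = comm_semiring_1 +
  assumes add_idempotent: "a + a = a"

text \<open>
  The canonical order is \<open>a \<le> b \<longleftrightarrow> a + b = b\<close>.  It is not made an instance of the order classes;
  totality is expressed directly.
\<close>

class totally_ordered_idempotent_semifield = idempotent_semiring +
  assumes nonzero_invertible: "a \<noteq> 0 \<Longrightarrow> \<exists>b. a * b = 1"
    and canonical_order_total: "a + b = b \<or> b + a = a"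

definition valuation :: "('k::comm_ring_1 \<Rightarrow> 's::idempotent_semiring) \<Rightarrow> bool" where
  "valuation \<nu> \<longleftrightarrow>
     \<nu> 0 = 0 \<and> \<nu> 1 = 1 \<and> \<nu> (- 1) = 1 \<and>
     (\<forall>a b. \<nu> (a * b) = \<nu> a * \<nu> b) \<and>
     (\<forall>a b. \<nu> (a + b) + \<nu> a + \<nu> b = \<nu> a + \<nu> b)"


subsection \<open>Polynomials in finitely many variables\<close>

text \<open>
  The variables are indexed by a finite type \<open>'v\<close>, so that \<open>('v, 'a) mpoly\<close> stands for
  \<open>'a[x\<^sub>0, \<dots>, x\<^sub>n]\<close> with \<open>n + 1 = CARD('v)\<close>.
\<close>

type_synonym ('v, 'a) mpoly = "('v \<Rightarrow>\<^sub>0 nat) \<Rightarrow>\<^sub>0 'a"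

definition monom_degree :: "('v::finite \<Rightarrow>\<^sub>0 nat) \<Rightarrow> nat" where
  "monom_degree m = (\<Sum>v\<in>UNIV. Poly_Mapping.lookup m v)"

definition forms :: "nat \<Rightarrow> ('v::finite, 'a::comm_semiring_1) mpoly set" where
  "forms d = {f. \<forall>m\<in>Poly_Mapping.keys f. monom_degree m = d}"

definition homogeneous_component ::
    "nat \<Rightarrow> ('v::finite, 'a::comm_semiring_1) mpoly \<Rightarrow> ('v, 'a) mpoly" where
  "homogeneous_component d f =
     (\<Sum>m\<in>{m \<in> Poly_Mapping.keys f. monom_degree m = d}.
        Poly_Mapping.single m (Poly_Mapping.lookup f m))"

definition scalar_mult ::
    "'a::comm_semiring_1 \<Rightarrow> ('v::finite, 'a) mpoly \<Rightarrow> ('v, 'a) mpoly" where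
  "scalar_mult c f = Poly_Mapping.map ((*) c) f"

definition delete_term ::
    "('v \<Rightarrow>\<^sub>0 nat) \<Rightarrow> ('v::finite, 'a::comm_semiring_1) mpoly \<Rightarrow> ('v, 'a) mpoly" where
  "delete_term m f = Poly_Mapping.update m 0 f"

definition submodule :: "('v::finite, 'a::comm_semiring_1) mpoly set \<Rightarrow> bool" where
  "submodule J \<longleftrightarrow>
     0 \<in> J \<and> (\<forall>f\<in>J. \<forall>g\<in>J. f + g \<in> J) \<and> (\<forall>c. \<forall>f\<in>J. scalar_mult c f \<in> J)"

definition polynomial_ideal :: "('v::finite, 'k::comm_ring_1) mpoly set \<Rightarrow> bool" where
  "polynomial_ideal I \<longleftrightarrow>
     0 \<in> I \<and> (\<forall>f\<in>I. \<forall>g\<in>I. f + g \<in> I) \<and> (\<forall>p. \<forall>f\<in>I. p * f \<in> I)"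

definition homogeneous_ideal :: "('v::finite, 'k::comm_ring_1) mpoly set \<Rightarrow> bool" where
  "homogeneous_ideal I \<longleftrightarrow>
     polynomial_ideal I \<and> (\<forall>f\<in>I. \<forall>d. homogeneous_component d f \<in> I)"


subsection \<open>Congruences and bend relations\<close>

type_synonym ('v, 'a) mpoly_rel = "(('v, 'a) mpoly \<times> ('v, 'a) mpoly) set"

definition module_congruence :: "('v::finite, 'a::comm_semiring_1) mpoly_rel \<Rightarrow> bool" where
  "module_congruence K \<longleftrightarrow>
     equiv UNIV K \<and>
     (\<forall>(f, g)\<in>K. \<forall>(f', g')\<in>K. (f + f', g + g') \<in> K) \<and>
     (\<forall>c. \<forall>(f, g)\<in>K. (scalar_mult c f, scalar_mult c g) \<in> K)"

definition semiring_congruence :: "('v::finite, 'a::comm_semiring_1) mpoly_rel \<Rightarrow> bool" where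
  "semiring_congruence K \<longleftrightarrow>
     equiv UNIV K \<and>
     (\<forall>(f, g)\<in>K. \<forall>(f', g')\<in>K. (f + f', g + g') \<in> K) \<and>
     (\<forall>(f, g)\<in>K. \<forall>(f', g')\<in>K. (f * f', g * g') \<in> K)"

text \<open>
  The grading descends to the quotient by \<open>K\<close> iff the sum of the images of the graded pieces is
  direct, i.e. iff congruent polynomials have congruent homogeneous components.
\<close>

definition homogeneous_congruence :: "('v::finite, 'a::comm_semiring_1) mpoly_rel \<Rightarrow> bool" where
  "homogeneous_congruence K \<longleftrightarrow>
     semiring_congruence K \<and>
     (\<forall>(f, g)\<in>K. \<forall>d. (homogeneous_component d f, homogeneous_component d g) \<in> K)"

definition bend_relations :: "('v::finite, 's::comm_semiring_1) mpoly \<Rightarrow> ('v, 's) mpoly_rel" where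
  "bend_relations f = {(f, delete_term m f) |m. m \<in> Poly_Mapping.keys f}"

definition bend_congruence ::
    "('v::finite, 's::comm_semiring_1) mpoly set \<Rightarrow> ('v, 's) mpoly_rel" where
  "bend_congruence J = \<Inter> {K. module_congruence K \<and> (\<forall>f\<in>J. bend_relations f \<subseteq> K)}"

definition trop_ideal ::
    "('k::comm_ring_1 \<Rightarrow> 's::idempotent_semiring) \<Rightarrow> ('v::finite, 'k) mpoly set \<Rightarrow> ('v, 's) mpoly set"
  where
  "trop_ideal \<nu> I = \<Inter> {J. submodule J \<and> (\<forall>f\<in>I. Poly_Mapping.map \<nu> f \<in> J)}"


subsection \<open>Modules over a semiring, dimension, dual\<close>

record ('s, 'm) semimodule =
  carrier :: "'m set"
  add :: "'m \<Rightarrow> 'm \<Rightarrow> 'm"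
  zero :: "'m"
  scale :: "'s \<Rightarrow> 'm \<Rightarrow> 'm"

inductive_set linear_combinations :: "('s, 'm) semimodule \<Rightarrow> 'm set \<Rightarrow> 'm set"
  for M :: "('s, 'm) semimodule" and V :: "'m set" where
  lc_zero: "zero M \<in> linear_combinations M V"
| lc_add: "v \<in> V \<Longrightarrow> x \<in> linear_combinations M V \<Longrightarrow>
     add M (scale M c v) x \<in> linear_combinations M V"

text \<open>
  Over a totally ordered idempotent semifield: \<open>V\<close> is dependent if each of its linear combinations is
  a linear combination of some proper subset, which may depend on the given combination.
\<close>

definition trop_dependent :: "('s, 'm) semimodule \<Rightarrow> 'm set \<Rightarrow> bool" where
  "trop_dependent M V \<longleftrightarrow>
     (\<forall>x\<in>linear_combinations M V. \<exists>W. W \<subset> V \<and> x \<in> linear_combinations M W)"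

definition trop_dim ::
    "('s::totally_ordered_idempotent_semifield, 'm) semimodule \<Rightarrow> enat" where
  "trop_dim M = (SUP V \<in> {V. finite V \<and> V \<subseteq> carrier M \<and> \<not> trop_dependent M V}. enat (card V))"

text \<open>
  Elements of the dual are extended by \<open>0\<close> outside the carrier, so that distinct elements
  of the dual are distinct as functions on the carrier.
\<close>

definition dual :: "('s::comm_semiring_1, 'm) semimodule \<Rightarrow> ('s, 'm \<Rightarrow> 's) semimodule" where
  "dual M =
     \<lparr> carrier = {\<phi>.
         (\<forall>x\<in>carrier M. \<forall>y\<in>carrier M. \<phi> (add M x y) = \<phi> x + \<phi> y) \<and>
         \<phi> (zero M) = 0 \<and>
         (\<forall>c. \<forall>x\<in>carrier M. \<phi> (scale M c x) = c * \<phi> x) \<and>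
         (\<forall>x. x \<notin> carrier M \<longrightarrow> \<phi> x = 0)},
       add = (\<lambda>\<phi> \<psi> x. \<phi> x + \<psi> x),
       zero = (\<lambda>x. 0),
       scale = (\<lambda>c \<phi> x. c * \<phi> x) \<rparr>"

text \<open>The usual dimension of a vector space.\<close>

definition linearly_independent :: "('k::field, 'm) semimodule \<Rightarrow> 'm set \<Rightarrow> bool" where
  "linearly_independent M V \<longleftrightarrow> (\<forall>v\<in>V. v \<notin> linear_combinations M (V - {v}))"

definition vector_space_dim :: "('k::field, 'm) semimodule \<Rightarrow> enat" where
  "vector_space_dim M =
     (SUP V \<in> {V. finite V \<and> V \<subseteq> carrier M \<and> linearly_independent M V}. enat (card V))"


subsection \<open>Graded quotients and Hilbert functions\<close>

definition degree_part ::
    "('v::finite, 'a::comm_semiring_1) mpoly_rel \<Rightarrow> nat \<Rightarrow> ('v, 'a) mpoly_rel" where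
  "degree_part K d = K \<inter> forms d \<times> forms d"

text \<open>The degree \<open>d\<close> piece of the quotient by a homogeneous congruence \<open>K\<close>.\<close>

definition graded_piece ::
    "('v::finite, 'a::comm_semiring_1) mpoly_rel \<Rightarrow> nat \<Rightarrow> ('a, ('v, 'a) mpoly set) semimodule" where
  "graded_piece K d =
     (let Kd = degree_part K d in
       \<lparr> carrier = forms d // Kd,
         add = (\<lambda>A B. \<Union>f\<in>A. \<Union>g\<in>B. Kd `` {f + g}),
         zero = Kd `` {0},
         scale = (\<lambda>c A. \<Union>f\<in>A. Kd `` {scalar_mult c f}) \<rparr>)"

definition ideal_congruence :: "('v::finite, 'k::comm_ring_1) mpoly set \<Rightarrow> ('v, 'k) mpoly_rel" where
  "ideal_congruence I = {(f, g). f - g \<in> I}"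

definition ideal_hilbert_function ::
    "('v::finite, 'k::field) mpoly set \<Rightarrow> nat \<Rightarrow> enat" where
  "ideal_hilbert_function I d = vector_space_dim (graded_piece (ideal_congruence I) d)"

definition congruence_hilbert_function ::
    "('v::finite, 's::totally_ordered_idempotent_semifield) mpoly_rel \<Rightarrow> nat \<Rightarrow> enat" where
  "congruence_hilbert_function K d = trop_dim (dual (graded_piece K d))"

definition eventually_polynomial :: "(nat \<Rightarrow> enat) \<Rightarrow> rat poly \<Rightarrow> bool" where
  "eventually_polynomial h P \<longleftrightarrow>
     (\<forall>\<^sub>F d in sequentially. \<exists>r. h d = enat r \<and> poly P (of_nat d) = of_nat r)"


subsection \<open>Closed subschemes of projective space\<close>

text \<open>
  A closed subscheme of projective space is represented by the set of all homogeneous ideals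
  (over a field), resp. homogeneous congruences (over an idempotent semiring), that define it; two of
  these define the same closed subscheme iff they coincide in all sufficiently large degrees.
  So \<open>I \<in> Z\<close>, resp. \<open>K \<in> X\<close>, reads ``\<open>I\<close> defines \<open>Z\<close>'', resp. ``\<open>K\<close> defines \<open>X\<close>''.
\<close>

definition Proj_ideal ::
    "('v::finite, 'k::field) mpoly set \<Rightarrow> ('v, 'k) mpoly set set" where
  "Proj_ideal I =
     {I'. homogeneous_ideal I' \<and> (\<forall>\<^sub>F d in sequentially. I' \<inter> forms d = I \<inter> forms d)}"

definition Proj_congruence ::
    "('v::finite, 's::idempotent_semiring) mpoly_rel \<Rightarrow> ('v, 's) mpoly_rel set" where
  "Proj_congruence K =
     {K'. homogeneous_congruence K' \<and>
          (\<forall>\<^sub>F d in sequentially. degree_part K' d = degree_part K d)}"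

definition closed_subscheme :: "('v::finite, 'k::field) mpoly set set \<Rightarrow> bool" where
  "closed_subscheme Z \<longleftrightarrow> (\<exists>I. homogeneous_ideal I \<and> Z = Proj_ideal I)"

definition Trop ::
    "('k::field \<Rightarrow> 's::idempotent_semiring) \<Rightarrow> ('v::finite, 'k) mpoly set set \<Rightarrow> ('v, 's) mpoly_rel set"
  where
  "Trop \<nu> Z = (THE X. \<forall>I\<in>Z. X = Proj_congruence (bend_congruence (trop_ideal \<nu> I)))"

definition saturation_of ::
    "('v::finite, 's::idempotent_semiring) mpoly_rel \<Rightarrow> ('v, 's) mpoly_rel \<Rightarrow> bool" where
  "saturation_of K K' \<longleftrightarrow>
     K' \<in> Proj_congruence K \<and> (\<forall>K''\<in>Proj_congruence K. K'' \<subseteq> K')"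

definition saturated :: "('v::finite, 's::idempotent_semiring) mpoly_rel \<Rightarrow> bool" where
  "saturated K \<longleftrightarrow> saturation_of K K"

text \<open>
  Congruences need not satisfy the ascending chain condition, and some closed subschemes are defined
  by no saturated congruence: let \<open>I\<close> be the ideal of the points \<open>(1:1:0)\<close>, \<open>(0:1:1)\<close>, \<open>(-1:0:1)\<close>
  over the rationals with the trivial valuation into the Boolean semifield.  For every odd \<open>d > 1\<close>
  the relation \<open>x\<^sub>0^d + x\<^sub>1^d + x\<^sub>2^d \<sim> x\<^sub>0^d + x\<^sub>1^d + x\<^sub>2^d + x\<^sub>0^(d-1) x\<^sub>1\<close> does not hold in
  \<open>bend_congruence (trop_ideal \<nu> I)\<close>, but each of its multiples by a monomial of positive degree does,
  so every defining congruence can be enlarged.  In that case an arbitrary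
  defining congruence is used; the values in large degrees do not depend on it.
\<close>

definition defining_congruence ::
    "('v::finite, 's::idempotent_semiring) mpoly_rel set \<Rightarrow> ('v, 's) mpoly_rel" where
  "defining_congruence X =
     (if \<exists>K\<in>X. saturated K then THE K. K \<in> X \<and> saturated K else SOME K. K \<in> X)"

definition trop_hilbert_polynomial ::
    "('v::finite, 's::totally_ordered_idempotent_semifield) mpoly_rel set \<Rightarrow> rat poly \<Rightarrow> bool" where
  "trop_hilbert_polynomial X P \<longleftrightarrow>
     eventually_polynomial (congruence_hilbert_function (defining_congruence X)) P"

definition hilbert_polynomial :: "('v::finite, 'k::field) mpoly set set \<Rightarrow> rat poly \<Rightarrow> bool" where
  "hilbert_polynomial Z P \<longleftrightarrow> (\<forall>I\<in>Z. eventually_polynomial (ideal_hilbert_function I) P)"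

end

theory Submission
  imports Defs
begin

text \<open>
  Let \<open>I\<close> be a homogeneous ideal and \<open>B\<close> the set of its standard monomials of degree \<open>d\<close>, the
  monomials of degree \<open>d\<close> that are not leading monomials of elements of \<open>I\<close> for a lexicographic order.
  For every \<open>d\<close>, the Hilbert functions of \<open>I\<close> and of the bend congruence of its tropicalization both
  take the value \<open>card B\<close> at \<open>d\<close>.

  Classically this is Macaulay's theorem: the classes of \<open>B\<close> form a basis of the degree \<open>d\<close> part of the
  quotient (\<open>ideal_hilbert_function_eq\<close>).  On the tropical side, the dual of the degree \<open>d\<close> part of the
  quotient by the bend congruence consists of the vectors \<open>w\<close>, indexed by the monomials of degree
  \<open>d\<close>, such that in every \<open>\<Sum>m. \<nu>(f\<^sub>m) w\<^sub>m\<close> with \<open>f \<in> I\<close> of degree \<open>d\<close> each single term may be omitted.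
  Two arguments give its dimension (\<open>congruence_hilbert_function_bend_trop_ideal\<close>).

  \<^item> Lower bound.  The coordinate functionals of the quotient with respect to the basis \<open>B\<close> vanish
    on \<open>I\<close>.  Their coefficientwise valuations are therefore in the dual, and they restrict to the unit
    vectors on \<open>B\<close>.  The sum of all of them is not a combination of fewer.

  \<^item> Upper bound (\<open>trop_dim_dual_le\<close>).  If some combination \<open>\<Sum> c\<^sub>v v\<close> of a set \<open>V\<close> needs every \<open>v \<in> V\<close>, each
    \<open>v\<close> has a monomial \<open>e\<^sub>v\<close> at which the term \<open>c\<^sub>v v\<close> strictly exceeds all the others.  If also
    \<open>card V > card B\<close>, then some nonzero \<open>f \<in> I\<close> is supported on the monomials \<open>e\<^sub>v\<close>.  For the \<open>v\<close> that
    maximizes \<open>\<nu>(f\<^bsub>e\<^sub>v\<^esub>) c\<^sub>v v(e\<^sub>v)\<close>, the maximum in the bend relation of \<open>f\<close> evaluated at \<open>v\<close> is attained only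
    once, a contradiction.

  The leading monomials form a monomial ideal, so \<open>card B\<close> is eventually a polynomial in \<open>d\<close>
  (\<open>monomial_ideal_hilbert_polynomial\<close>, by Dickson's lemma and induction on the number of generators).

  Passing from ideals to schemes uses that the bend congruence in degree \<open>d\<close> depends only on the
  forms of degree \<open>d\<close> in \<open>I\<close> (\<open>degree_part_bend_trop_ideal\<close>): hence all ideals that define \<open>Z\<close> have the
  same tropicalization, and every congruence that defines it has the same Hilbert function in
  large degrees.
\<close>

section \<open>Monomials outside a monomial ideal\<close>

lemma monom_degree_add: "monom_degree (m + m') = monom_degree m + monom_degree m'"
  by (simp add: monom_degree_def lookup_add sum.distrib)

definition monom_dvd :: "('v \<Rightarrow>\<^sub>0 nat) \<Rightarrow> ('v \<Rightarrow>\<^sub>0 nat) \<Rightarrow> bool" where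
  "monom_dvd g m \<longleftrightarrow> (\<forall>v. Poly_Mapping.lookup g v \<le> Poly_Mapping.lookup m v)"

lemma monom_dvd_iff: "monom_dvd g m \<longleftrightarrow> (\<exists>t. m = g + t)"
proof
  assume "monom_dvd g m"
  hence "m = g + (m - g)"
    by (intro poly_mapping_eqI) (simp add: monom_dvd_def lookup_add lookup_minus)
  thus "\<exists>t. m = g + t" ..
qed (auto simp: monom_dvd_def lookup_add)

lemma monom_dvd_refl: "monom_dvd m m"
  by (simp add: monom_dvd_def)

lemma monom_dvd_trans: "monom_dvd a b \<Longrightarrow> monom_dvd b c \<Longrightarrow> monom_dvd a c"
  by (meson monom_dvd_def le_trans)

lemma monom_dvd_add_iff: "monom_dvd g' (g + t) \<longleftrightarrow> monom_dvd (g' - g) t"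
  by (auto simp: monom_dvd_def lookup_add lookup_minus) (metis add.commute le_diff_conv)+

lemma monom_dvd_degree_eq:
  assumes "monom_dvd g m" "monom_degree m \<le> monom_degree (g :: 'v::finite \<Rightarrow>\<^sub>0 nat)" shows "g = m"
proof -
  obtain t where t: "m = g + t" using assms(1) by (auto simp: monom_dvd_iff)
  hence "monom_degree t = 0" using assms(2) by (simp add: monom_degree_add)
  hence "t = 0" by (intro poly_mapping_eqI) (simp add: monom_degree_def)
  thus ?thesis by (simp add: t)
qed

text \<open>
  A monotone subsequence that is not increasing is decreasing, and a decreasing sequence of
  natural numbers is eventually constant.
\<close>

lemma nat_seq_mono_subseq:
  fixes s :: "nat \<Rightarrow> nat"
  obtains r :: "nat \<Rightarrow> nat" where "strict_mono r" "mono (\<lambda>n. s (r n))"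
proof -
  obtain r :: "nat \<Rightarrow> nat" where r: "strict_mono r" "monoseq (\<lambda>n. s (r n))"
    using seq_monosub by blast
  show ?thesis
  proof (cases "mono (\<lambda>n. s (r n))")
    case True
    thus ?thesis using r that by blast
  next
    case False
    hence dec: "s (r n) \<le> s (r m)" if "m \<le> n" for m n
      using r(2) that by (auto simp: monoseq_def mono_def)
    obtain N where N: "\<And>n. s (r N) \<le> s (r n)"
      using ex_has_least_nat[of "\<lambda>_. True" 0 "\<lambda>n. s (r n)"] by auto
    have "s (r (N + n)) = s (r N)" for n
      using dec[of N "N + n"] N[of "N + n"] by simp
    moreover have "strict_mono (\<lambda>n. r (N + n))"
      using r(1) by (simp add: strict_mono_def)
    ultimately show ?thesis
      by (intro that[of "\<lambda>n. r (N + n)"]) (auto simp: mono_def)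
  qed
qed

text \<open>
  Exponents are made increasing one variable after the other; passing to a further subsequence keeps
  the earlier variables increasing.
\<close>

lemma monomial_seq_mono_subseq:
  fixes f :: "nat \<Rightarrow> ('v \<Rightarrow>\<^sub>0 nat)"
  assumes "finite W"
  shows "\<exists>r :: nat \<Rightarrow> nat. strict_mono r \<and> (\<forall>v\<in>W. mono (\<lambda>n. Poly_Mapping.lookup (f (r n)) v))"
  using assms
proof (induction W)
  case empty
  show ?case by (intro exI[of _ id]) (simp add: strict_mono_def)
next
  case (insert v W)
  then obtain r :: "nat \<Rightarrow> nat" where r: "strict_mono r" "\<forall>v\<in>W. mono (\<lambda>n. Poly_Mapping.lookup (f (r n)) v)"
    by blast
  obtain q :: "nat \<Rightarrow> nat" where q: "strict_mono q" "mono (\<lambda>n. Poly_Mapping.lookup (f (r (q n))) v)"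
    using nat_seq_mono_subseq[of "\<lambda>n. Poly_Mapping.lookup (f (r n)) v"] by blast
  have "strict_mono (\<lambda>n. r (q n))"
    using r(1) q(1) by (simp add: strict_mono_def)
  moreover have "mono (\<lambda>n. Poly_Mapping.lookup (f (r (q n))) w)" if "w \<in> W" for w
    using r(2) q(1) that by (auto simp: mono_def strict_mono_less_eq)
  ultimately show ?case using q(2) by (intro exI[of _ "\<lambda>n. r (q n)"]) auto
qed

text \<open>
  The minimal elements of \<open>U\<close> for divisibility generate it.  They form an antichain, and an antichain
  is finite because an infinite sequence of monomials has a subsequence that increases in every
  variable.
\<close>

lemma Dickson:
  fixes U :: "('v::finite \<Rightarrow>\<^sub>0 nat) set"
  obtains G where "finite G" "G \<subseteq> U" "\<And>m. m \<in> U \<Longrightarrow> \<exists>g\<in>G. monom_dvd g m"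
proof -
  define G where "G = {g \<in> U. \<forall>m\<in>U. monom_dvd m g \<longrightarrow> m = g}"
  have gen: "\<exists>g\<in>G. monom_dvd g m" if m: "m \<in> U" for m
  proof -
    obtain g where g: "g \<in> U" "monom_dvd g m"
      and least: "\<And>h. h \<in> U \<Longrightarrow> monom_dvd h m \<Longrightarrow> monom_degree g \<le> monom_degree h"
      using ex_has_least_nat[of "\<lambda>g. g \<in> U \<and> monom_dvd g m" m monom_degree] m monom_dvd_refl[of m]
      by blast
    have "g \<in> G"
      using g least monom_dvd_degree_eq monom_dvd_trans unfolding G_def by blast
    thus ?thesis using g by blast
  qed
  have "finite G"
  proof (rule ccontr)
    assume "infinite G"
    then obtain f :: "nat \<Rightarrow> 'v \<Rightarrow>\<^sub>0 nat" where f: "inj f" "range f \<subseteq> G"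
      using infinite_countable_subset by blast
    obtain r :: "nat \<Rightarrow> nat" where r: "strict_mono r" "\<And>v. mono (\<lambda>n. Poly_Mapping.lookup (f (r n)) v)"
      using monomial_seq_mono_subseq[of UNIV f] by auto
    have "monom_dvd (f (r 0)) (f (r 1))"
      using r(2) by (auto simp: monom_dvd_def mono_def)
    moreover have "f (r 0) \<in> G" "f (r 1) \<in> G" using f(2) by auto
    ultimately have "f (r 0) = f (r 1)" by (auto simp: G_def)
    hence "r 0 = r 1" using f(1) by (auto dest: injD)
    thus False using r(1) by (metis strict_mono_eq zero_neq_one)
  qed
  thus ?thesis using gen that[of G] by (auto simp: G_def)
qed

lemma card_monomials_of_degree:
  "finite {m :: 'v::finite \<Rightarrow>\<^sub>0 nat. monom_degree m = d}"
  "card {m :: 'v \<Rightarrow>\<^sub>0 nat. monom_degree m = d} = (d + card (UNIV :: 'v set) - 1) choose d"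
proof -
  obtain vs :: "'v list" where vs: "set vs = UNIV" "distinct vs"
    using finite_distinct_list[OF finite_UNIV] by blast
  have len: "length vs = card (UNIV :: 'v set)" using vs distinct_card by fastforce
  define F :: "('v \<Rightarrow>\<^sub>0 nat) \<Rightarrow> nat list" where "F m = map (Poly_Mapping.lookup m) vs" for m
  have sum_F: "sum_list (F m) = monom_degree m" for m
    using vs by (simp add: F_def monom_degree_def sum_list_distinct_conv_sum_set)
  have inj: "inj F"
    by (rule injI) (auto simp: F_def vs intro: poly_mapping_eqI)
  have surj: "\<exists>m. F m = l" if "length l = card (UNIV :: 'v set)" for l
  proof -
    define m where "m = Abs_poly_mapping (\<lambda>v. the (map_of (zip vs l) v))"
    have "Poly_Mapping.lookup m = (\<lambda>v. the (map_of (zip vs l) v))"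
      unfolding m_def by (intro lookup_Abs_poly_mapping) (rule finite)
    hence "F m = l"
      unfolding F_def using that len vs(2)
      by (intro nth_equalityI) (auto simp: map_of_zip_nth)
    thus ?thesis ..
  qed
  have bij: "bij_betw F {m. monom_degree m = d} {l. size l = card (UNIV :: 'v set) \<and> sum_list l = d}"
    unfolding bij_betw_def
  proof
    show "inj_on F {m. monom_degree m = d}" using inj inj_on_subset by blast
    show "F ` {m. monom_degree m = d} = {l. size l = card (UNIV :: 'v set) \<and> sum_list l = d}"
    proof (intro equalityI subsetI)
      fix l :: "nat list" assume l: "l \<in> {l. size l = card (UNIV :: 'v set) \<and> sum_list l = d}"
      then obtain m where "F m = l" using surj by blast
      thus "l \<in> F ` {m. monom_degree m = d}" using l sum_F by force
    qed (auto simp: sum_F, simp add: F_def len)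
  qed
  show c: "card {m :: 'v \<Rightarrow>\<^sub>0 nat. monom_degree m = d} = (d + card (UNIV :: 'v set) - 1) choose d"
    using bij_betw_same_card[OF bij] by (simp add: card_length_sum_list)
  \<comment> \<open>Infinite sets have cardinality \<open>0\<close>, so a positive cardinality proves finiteness.\<close>
  have "(d + card (UNIV :: 'v set) - 1) choose d > 0"
    using finite_UNIV_card_ge_0[where 'a = 'v] by (intro zero_less_binomial) simp
  thus "finite {m :: 'v::finite \<Rightarrow>\<^sub>0 nat. monom_degree m = d}"
    by (intro card_ge_0_finite) (simp only: c)
qed

lemma card_monomials_polynomial:
  "\<exists>P :: rat poly. \<forall>d. of_nat (card {m :: 'v::finite \<Rightarrow>\<^sub>0 nat. monom_degree m = d}) = poly P (of_nat d)"
proof -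
  obtain n where n: "card (UNIV :: 'v set) = Suc n" 
    using gr0_implies_Suc[of "card (UNIV :: 'v set)"] by (auto simp: card_gt_0_iff)
  define P :: "rat poly" where
    "P = smult (1 / fact n) (\<Prod>i = 0..<n. [:of_nat n - of_nat i, 1:])"
  have "of_nat (card {m :: 'v::finite \<Rightarrow>\<^sub>0 nat. monom_degree m = d}) = poly P (of_nat d)" for d
  proof -
    have "(d + n) choose d = (d + n) choose n"
      using binomial_symmetric[of d "d + n"] by simp
    hence "of_nat (card {m :: 'v::finite \<Rightarrow>\<^sub>0 nat. monom_degree m = d}) = of_nat (d + n) gchoose n"
      by (simp add: card_monomials_of_degree n binomial_gbinomial flip: of_nat_add)
    also have "\<dots> = (poly P (of_nat d) :: rat)"
      by (simp add: P_def gbinomial_prod_rev poly_prod algebra_simps)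
    finally show ?thesis .
  qed
  thus ?thesis by blast
qed

text \<open>
  Adding a generator \<open>g\<close> to a monomial ideal \<open>J\<close> removes from the complement the multiples of \<open>g\<close> that
  are not in \<open>J\<close>.  These are the products \<open>g t\<close> with \<open>t\<close> outside the colon ideal of \<open>J\<close> by \<open>g\<close>, which is
  generated by the truncated differences \<open>h - g\<close>, so by no more elements than \<open>J\<close>.
\<close>

lemma generated_monomial_ideal_hilbert_polynomial:
  fixes gs :: "('v::finite \<Rightarrow>\<^sub>0 nat) list"
  shows "\<exists>P :: rat poly. \<forall>\<^sub>F d in sequentially.
    of_nat (card {m. monom_degree m = d \<and> \<not> (\<exists>g\<in>set gs. monom_dvd g m)}) = poly P (of_nat d)"
proof (induction "length gs" arbitrary: gs)
  case 0
  obtain P :: "rat poly" where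
    "\<forall>d. of_nat (card {m :: 'v \<Rightarrow>\<^sub>0 nat. monom_degree m = d}) = poly P (of_nat d)"
    using card_monomials_polynomial by blast
  thus ?case using 0 by (intro exI[of _ P]) simp
next
  case (Suc n)
  define N where
    "N hs d = {m. monom_degree m = d \<and> \<not> (\<exists>g\<in>set hs. monom_dvd g m)}"
    for hs :: "('v \<Rightarrow>\<^sub>0 nat) list" and d
  have finN: "finite (N hs d)" for hs d
    by (rule finite_subset[OF _ card_monomials_of_degree(1)[of d]]) (auto simp: N_def)
  obtain g hs where gs: "gs = g # hs" using Suc(2) by (cases gs) auto
  define hs' where "hs' = map (\<lambda>h. h - g) hs"
  obtain P P' :: "rat poly" where
      P: "\<forall>\<^sub>F d in sequentially. of_nat (card (N hs d)) = poly P (of_nat d)"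
    and P': "\<forall>\<^sub>F d in sequentially. of_nat (card (N hs' d)) = poly P' (of_nat d)"
    using Suc(1)[of hs] Suc(1)[of hs'] Suc(2) unfolding gs hs'_def N_def by auto
  define k where "k = monom_degree g"
  have P'': "\<forall>\<^sub>F d in sequentially. of_nat (card (N hs' (d - k))) = poly P' (of_nat (d - k))"
    using P' filterlim_minus_const_nat_at_top[of k] by (rule eventually_compose_filterlim)
  have rec: "card (N gs d) + card (N hs' (d - k)) = card (N hs d)" if "d \<ge> k" for d
  proof -
    have "N hs d = N gs d \<union> (\<lambda>t. g + t) ` N hs' (d - k)"
    proof (intro equalityI subsetI)
      fix m assume m: "m \<in> N hs d"
      show "m \<in> N gs d \<union> (\<lambda>t. g + t) ` N hs' (d - k)"
      proof (cases "monom_dvd g m")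
        case True
        then obtain t where "m = g + t" by (auto simp: monom_dvd_iff)
        thus ?thesis using m
          by (auto simp: N_def hs'_def monom_dvd_add_iff monom_degree_add k_def)
      qed (use m in \<open>auto simp: N_def gs\<close>)
    qed (use that in \<open>auto simp: N_def gs hs'_def monom_dvd_add_iff monom_degree_add k_def\<close>)
    moreover have "N gs d \<inter> (\<lambda>t. g + t) ` N hs' (d - k) = {}"
      by (auto simp: N_def gs monom_dvd_iff)
    moreover have "card ((\<lambda>t. g + t) ` N hs' (d - k)) = card (N hs' (d - k))"
      by (intro card_image inj_onI) auto
    ultimately show ?thesis by (simp add: card_Un_disjoint finN)
  qed
  \<comment> \<open>The composition is \<open>P' (d - k)\<close>.\<close>
  define Q where "Q = P - pcompose P' [:- of_nat k, 1:]"
  have "\<forall>\<^sub>F d in sequentially. of_nat (card (N gs d)) = poly Q (of_nat d)"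
    using P P'' eventually_ge_at_top[of k]
  proof eventually_elim
    case (elim d)
    have "of_nat (card (N gs d)) = of_nat (card (N hs d)) - (of_nat (card (N hs' (d - k))) :: rat)"
      unfolding rec[OF elim(3), symmetric] by simp
    also have "\<dots> = poly Q (of_nat d)"
      unfolding elim by (simp add: Q_def poly_pcompose of_nat_diff[OF elim(3)])
    finally show ?case .
  qed
  thus ?case unfolding N_def by blast
qed

lemma monomial_ideal_hilbert_polynomial:
  fixes U :: "('v::finite \<Rightarrow>\<^sub>0 nat) set"
  assumes "\<And>m t. m \<in> U \<Longrightarrow> m + t \<in> U"
  shows "\<exists>P :: rat poly. \<forall>\<^sub>F d in sequentially.
    of_nat (card {m. monom_degree m = d \<and> m \<notin> U}) = poly P (of_nat d)"
proof -
  obtain G where G: "finite G" "G \<subseteq> U" "\<And>m. m \<in> U \<Longrightarrow> \<exists>g\<in>G. monom_dvd g m"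
    using Dickson[of U] by blast
  obtain gs where gs: "set gs = G" using G(1) finite_list by blast
  have "m \<in> U \<longleftrightarrow> (\<exists>g\<in>set gs. monom_dvd g m)" for m
    using G assms by (auto simp: gs monom_dvd_iff)
  thus ?thesis using generated_monomial_ideal_hilbert_polynomial[of gs] by simp
qed

section \<open>Polynomials and forms\<close>

lemma lookup_map_zero:
  "h 0 = 0 \<Longrightarrow> Poly_Mapping.lookup (Poly_Mapping.map h f) m = h (Poly_Mapping.lookup f m)"
  by (simp add: map.rep_eq when_def)

lemma keys_map_zero: "h 0 = 0 \<Longrightarrow> Poly_Mapping.keys (Poly_Mapping.map h f) \<subseteq> Poly_Mapping.keys f"
  by (metis in_keys_iff lookup_map_zero subsetI)

lemma lookup_scalar_mult [simp]:
  "Poly_Mapping.lookup (scalar_mult c f) m = c * Poly_Mapping.lookup f m"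
  by (simp add: scalar_mult_def lookup_map_zero)

lemma lookup_delete_term:
  "Poly_Mapping.lookup (delete_term m f) k = (if k = m then 0 else Poly_Mapping.lookup f k)"
  by (simp add: delete_term_def lookup_update)

lemma keys_delete_term: "Poly_Mapping.keys (delete_term m f) = Poly_Mapping.keys f - {m}"
  by (simp add: delete_term_def keys_update)

lemma lookup_homogeneous_component:
  "Poly_Mapping.lookup (homogeneous_component d f) m =
     (if monom_degree m = d then Poly_Mapping.lookup f m else 0)"
  by (auto simp: homogeneous_component_def lookup_sum lookup_single when_def sum.delta'
      in_keys_iff)

lemma sum_single_lookup:
  assumes "finite A" "Poly_Mapping.keys f \<subseteq> A"
  shows "(\<Sum>m\<in>A. Poly_Mapping.single m (Poly_Mapping.lookup f m)) = f"
  using assms by (intro poly_mapping_eqI) (auto simp: lookup_sum lookup_single when_def in_keys_iff)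

lemma lookup_single_times:
  fixes f :: "('v::finite, 'a::comm_semiring_1) mpoly"
  shows "Poly_Mapping.lookup (Poly_Mapping.single t c * f) (t + m) = c * Poly_Mapping.lookup f m"
    and "(\<And>m. k \<noteq> t + m) \<Longrightarrow> Poly_Mapping.lookup (Poly_Mapping.single t c * f) k = 0"
proof -
  have *: "Poly_Mapping.single t c * f =
      (\<Sum>m\<in>Poly_Mapping.keys f. Poly_Mapping.single (t + m) (c * Poly_Mapping.lookup f m))"
    using sum_single_lookup[of "Poly_Mapping.keys f" f]
    by (metis (no_types, lifting) finite_keys mult_single order_refl sum.cong sum_distrib_left)
  show "Poly_Mapping.lookup (Poly_Mapping.single t c * f) (t + m) = c * Poly_Mapping.lookup f m"
    unfolding * by (simp add: lookup_sum lookup_single when_def in_keys_iff)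
  show "Poly_Mapping.lookup (Poly_Mapping.single t c * f) k = 0" if "\<And>m. k \<noteq> t + m"
    unfolding * lookup_sum using that[symmetric]
    by (intro sum.neutral ballI) (simp add: lookup_single when_def)
qed

lemma scalar_mult_eq_times: "scalar_mult c f = Poly_Mapping.single 0 c * f"
  by (simp add: scalar_mult_def mult_map_scale_conv_mult)

lemma scalar_mult_0 [simp]: "scalar_mult 0 f = 0" "scalar_mult c 0 = 0"
  by (auto intro!: poly_mapping_eqI)

lemma scalar_mult_1 [simp]: "scalar_mult 1 f = f"
  by (auto intro!: poly_mapping_eqI)

lemma scalar_mult_add_left: "scalar_mult (c + c') f = scalar_mult c f + scalar_mult c' f"
  by (auto intro!: poly_mapping_eqI simp: lookup_add algebra_simps)

lemma forms_iff: "f \<in> forms d \<longleftrightarrow> (\<forall>m. Poly_Mapping.lookup f m \<noteq> 0 \<longrightarrow> monom_degree m = d)"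
  by (auto simp: forms_def in_keys_iff)

lemma zero_forms [simp]: "0 \<in> forms d"
  by (simp add: forms_iff)

lemma add_forms: "f \<in> forms d \<Longrightarrow> g \<in> forms d \<Longrightarrow> f + g \<in> forms d"
  unfolding forms_iff lookup_add by (metis add_0)

lemma diff_forms: "f \<in> forms d \<Longrightarrow> g \<in> forms d \<Longrightarrow> f - g \<in> forms d"
  for f :: "('v::finite, 'a::comm_ring_1) mpoly"
  unfolding forms_iff lookup_minus by (metis diff_zero)

lemma scalar_mult_forms: "f \<in> forms d \<Longrightarrow> scalar_mult c f \<in> forms d"
  unfolding forms_iff lookup_scalar_mult by (metis mult_zero_right)

lemma sum_forms: "(\<And>i. i \<in> A \<Longrightarrow> f i \<in> forms d) \<Longrightarrow> sum f A \<in> forms d"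
  by (induction A rule: infinite_finite_induct) (auto intro: add_forms)

lemma single_forms: "monom_degree m = d \<Longrightarrow> Poly_Mapping.single m c \<in> forms d"
  by (auto simp: forms_iff lookup_single when_def split: if_splits)

lemma homogeneous_component_forms: "homogeneous_component d f \<in> forms d"
  by (simp add: forms_iff lookup_homogeneous_component)

lemma homogeneous_component_id: "f \<in> forms d \<Longrightarrow> homogeneous_component d f = f"
  by (intro poly_mapping_eqI) (auto simp: forms_iff lookup_homogeneous_component)

section \<open>Standard monomials of a polynomial ideal\<close>

text \<open>
  Numbering the variables embeds the monomials into \<open>nat \<Rightarrow>\<^sub>0 nat\<close>, whose linear order is
  lexicographic and compatible with addition.
\<close>

definition lex_key :: "('v::finite \<Rightarrow>\<^sub>0 nat) \<Rightarrow> (nat \<Rightarrow>\<^sub>0 nat)" where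
  "lex_key m = (\<Sum>v\<in>UNIV. Poly_Mapping.single (to_nat v) (Poly_Mapping.lookup m v))"

lemma lookup_lex_key: "Poly_Mapping.lookup (lex_key m) (to_nat v) = Poly_Mapping.lookup m v"
  by (simp add: lex_key_def lookup_sum lookup_single when_def)

lemma lex_key_inject: "lex_key m = lex_key m' \<longleftrightarrow> m = m'"
  by (metis lookup_lex_key poly_mapping_eqI)

lemma lex_key_add: "lex_key (m + m') = lex_key m + lex_key m'"
  by (simp add: lex_key_def lookup_add single_add sum.distrib)

text \<open>
  Only leading monomials of forms are taken.  All comparisons then stay within one degree, where
  there are finitely many monomials, so that induction along the monomial order is available.
\<close>

definition leading_monomials :: "('v::finite, 'k::comm_ring_1) mpoly set \<Rightarrow> ('v \<Rightarrow>\<^sub>0 nat) set" where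
  "leading_monomials I =
     {m. \<exists>f\<in>I. f \<in> forms (monom_degree m) \<and> m \<in> Poly_Mapping.keys f \<and>
           (\<forall>m'\<in>Poly_Mapping.keys f. lex_key m' \<le> lex_key m)}"

definition standard_monomials ::
    "('v::finite, 'k::comm_ring_1) mpoly set \<Rightarrow> nat \<Rightarrow> ('v \<Rightarrow>\<^sub>0 nat) set" where
  "standard_monomials I d = {m. monom_degree m = d \<and> m \<notin> leading_monomials I}"

lemma finite_standard_monomials: "finite (standard_monomials I d)"
  by (rule finite_subset[OF _ card_monomials_of_degree(1)[of d]])
    (auto simp: standard_monomials_def)

lemma ideal_add: "polynomial_ideal I \<Longrightarrow> f \<in> I \<Longrightarrow> g \<in> I \<Longrightarrow> f + g \<in> I"
  by (simp add: polynomial_ideal_def)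

lemma ideal_times: "polynomial_ideal I \<Longrightarrow> f \<in> I \<Longrightarrow> p * f \<in> I"
  by (simp add: polynomial_ideal_def)

lemma ideal_zero: "polynomial_ideal I \<Longrightarrow> 0 \<in> I"
  by (simp add: polynomial_ideal_def)

lemma ideal_scalar_mult: "polynomial_ideal I \<Longrightarrow> f \<in> I \<Longrightarrow> scalar_mult c f \<in> I"
  by (simp add: scalar_mult_eq_times ideal_times)

lemma ideal_diff: "polynomial_ideal I \<Longrightarrow> f \<in> I \<Longrightarrow> g \<in> I \<Longrightarrow> f - g \<in> I"
  using ideal_add[of I f "(-1) * g"] ideal_times[of I g "-1"] by simp

lemma ideal_sum: "polynomial_ideal I \<Longrightarrow> (\<And>i. i \<in> A \<Longrightarrow> f i \<in> I) \<Longrightarrow> sum f A \<in> I"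
  by (induction A rule: infinite_finite_induct) (auto intro: ideal_add ideal_zero)

lemma leading_monomials_add:
  fixes I :: "('v::finite, 'k::field) mpoly set"
  assumes "polynomial_ideal I" "m \<in> leading_monomials I"
  shows "m + t \<in> leading_monomials I"
proof -
  obtain f where f: "f \<in> I" "f \<in> forms (monom_degree m)" "m \<in> Poly_Mapping.keys f"
    "\<And>m'. m' \<in> Poly_Mapping.keys f \<Longrightarrow> lex_key m' \<le> lex_key m"
    using assms(2) by (auto simp: leading_monomials_def)
  define g where "g = Poly_Mapping.single t 1 * f"
  have g_I: "g \<in> I" unfolding g_def using assms(1) f(1) by (rule ideal_times)
  have keys_g: "\<exists>m'\<in>Poly_Mapping.keys f. k = t + m'" if k: "k \<in> Poly_Mapping.keys g" for k
  proof -
    obtain m' where m': "k = t + m'"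
      using k lookup_single_times(2)[of k t 1 f] unfolding g_def in_keys_iff by blast
    thus ?thesis using k lookup_single_times(1)[of t 1 f m'] by (auto simp: g_def in_keys_iff)
  qed
  have "m + t \<in> Poly_Mapping.keys g"
    using f(3) lookup_single_times(1)[of t 1 f m] by (simp add: g_def in_keys_iff add.commute)
  moreover have "g \<in> forms (monom_degree (m + t))"
    unfolding forms_def using keys_g f(2) by (fastforce simp: forms_def monom_degree_add)
  moreover have "lex_key k \<le> lex_key (m + t)" if k: "k \<in> Poly_Mapping.keys g" for k
  proof -
    obtain m' where "m' \<in> Poly_Mapping.keys f" "k = t + m'" using keys_g[OF k] by blast
    thus ?thesis using f(4) by (simp add: lex_key_add add.commute add_right_mono)
  qed
  ultimately show ?thesis using g_I by (auto simp: leading_monomials_def)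
qed

lemma standard_monomials_polynomial:
  fixes I :: "('v::finite, 'k::field) mpoly set"
  assumes "polynomial_ideal I"
  shows "\<exists>P :: rat poly. \<forall>\<^sub>F d in sequentially.
    of_nat (card (standard_monomials I d)) = poly P (of_nat d)"
  unfolding standard_monomials_def
  by (rule monomial_ideal_hilbert_polynomial) (rule leading_monomials_add[OF assms])

text \<open>
  The largest monomial of a nonzero element of \<open>I\<close> of degree \<open>d\<close> is a leading monomial.
\<close>

lemma standard_monomials_independent:
  assumes "f \<in> I" "Poly_Mapping.keys f \<subseteq> standard_monomials I d"
  shows "f = 0"
proof (rule ccontr)
  assume "f \<noteq> 0"
  hence "Poly_Mapping.keys f \<noteq> {}" by (metis in_keys_iff empty_iff lookup_zero poly_mapping_eqI)
  then obtain m where m: "m \<in> Poly_Mapping.keys f"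
    "\<And>m'. m' \<in> Poly_Mapping.keys f \<Longrightarrow> lex_key m' \<le> lex_key m"
    using finite_keys[of f] Max_in[of "lex_key ` Poly_Mapping.keys f"]
      Max_ge[of "lex_key ` Poly_Mapping.keys f"]
    by (smt (verit) finite_imageI image_iff image_is_empty)
  have "m \<in> leading_monomials I"
    using assms m by (auto simp: leading_monomials_def forms_def standard_monomials_def)
  thus False using m(1) assms(2) by (auto simp: standard_monomials_def)
qed

lemma keys_linear_combination:
  assumes "\<And>i. i \<in> A \<Longrightarrow> Poly_Mapping.keys (g i) \<subseteq> B"
  shows "Poly_Mapping.keys (\<Sum>i\<in>A. scalar_mult (c i) (g i)) \<subseteq> B"
proof
  fix k assume "k \<in> Poly_Mapping.keys (\<Sum>i\<in>A. scalar_mult (c i) (g i))"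
  hence "(\<Sum>i\<in>A. c i * Poly_Mapping.lookup (g i) k) \<noteq> 0"
    by (simp add: in_keys_iff lookup_sum)
  then obtain i where "i \<in> A" "c i * Poly_Mapping.lookup (g i) k \<noteq> 0"
    using sum.not_neutral_contains_not_neutral by blast
  hence "i \<in> A" "k \<in> Poly_Mapping.keys (g i)" by (auto simp: in_keys_iff)
  thus "k \<in> B" using assms by blast
qed

text \<open>
  A leading monomial is replaced by smaller monomials of the same degree, by means of an element of
  \<open>I\<close> which it leads.  This stops, by induction on the number of smaller monomials.
\<close>

lemma monomial_normal_form:
  fixes I :: "('v::finite, 'k::field) mpoly set"
  assumes I: "polynomial_ideal I" and "monom_degree m = d"
  shows "\<exists>g. Poly_Mapping.keys g \<subseteq> standard_monomials I d \<and> Poly_Mapping.single m 1 - g \<in> I"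
  using assms(2)
proof (induction "card {m' :: 'v \<Rightarrow>\<^sub>0 nat. monom_degree m' = d \<and> lex_key m' < lex_key m}" arbitrary: m
    rule: less_induct)
  case less
  show ?case
  proof (cases "m \<in> leading_monomials I")
    case False
    thus ?thesis using less.prems ideal_zero[OF I]
      by (intro exI[of _ "Poly_Mapping.single m 1"]) (simp add: standard_monomials_def)
  next
    case True
    then obtain f where f: "f \<in> I" "f \<in> forms (monom_degree m)" "m \<in> Poly_Mapping.keys f"
      "\<And>m'. m' \<in> Poly_Mapping.keys f \<Longrightarrow> lex_key m' \<le> lex_key m"
      by (auto simp: leading_monomials_def)
    define A where "A = Poly_Mapping.keys f - {m}"
    define c where "c m' = Poly_Mapping.lookup f m' / Poly_Mapping.lookup f m" for m'
    have "\<exists>g. Poly_Mapping.keys g \<subseteq> standard_monomials I d \<and> Poly_Mapping.single m' 1 - g \<in> I"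
      if m': "m' \<in> A" for m'
    proof (rule less.hyps)
      have deg: "monom_degree m' = d" using m' f(2) less.prems by (auto simp: A_def forms_def)
      have lt: "lex_key m' < lex_key m"
        using m' f(4)[of m'] by (auto simp: A_def order.strict_iff_order lex_key_inject)
      show "card {m'' :: 'v \<Rightarrow>\<^sub>0 nat. monom_degree m'' = d \<and> lex_key m'' < lex_key m'}
          < card {m' :: 'v \<Rightarrow>\<^sub>0 nat. monom_degree m' = d \<and> lex_key m' < lex_key m}"
      proof (rule psubset_card_mono)
        show "finite {m' :: 'v \<Rightarrow>\<^sub>0 nat. monom_degree m' = d \<and> lex_key m' < lex_key m}"
          by (rule finite_subset[OF _ card_monomials_of_degree(1)[of d]]) auto
        show "{m'' :: 'v \<Rightarrow>\<^sub>0 nat. monom_degree m'' = d \<and> lex_key m'' < lex_key m'}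
            \<subset> {m' :: 'v \<Rightarrow>\<^sub>0 nat. monom_degree m' = d \<and> lex_key m' < lex_key m}"
          using lt deg by (auto simp: psubset_eq) 
      qed
      show "monom_degree m' = d" by (fact deg)
    qed
    then obtain g where g: "\<And>m'. m' \<in> A \<Longrightarrow> Poly_Mapping.keys (g m') \<subseteq> standard_monomials I d"
      "\<And>m'. m' \<in> A \<Longrightarrow> Poly_Mapping.single m' 1 - g m' \<in> I"
      by metis
    define h where "h = (\<Sum>m'\<in>A. scalar_mult (- c m') (g m'))"
    have nz: "Poly_Mapping.lookup f m \<noteq> 0" using f(3) by (simp add: in_keys_iff)
    have "Poly_Mapping.single m 1 - h = scalar_mult (1 / Poly_Mapping.lookup f m) f
        - (\<Sum>m'\<in>A. scalar_mult (c m') (Poly_Mapping.single m' 1 - g m'))"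
    proof (rule poly_mapping_eqI)
      fix k
      have "(\<Sum>m'\<in>A. c m' * Poly_Mapping.lookup (Poly_Mapping.single m' 1 - g m') k)
          = (\<Sum>m'\<in>A. if m' = k then c k else 0) - (\<Sum>m'\<in>A. c m' * Poly_Mapping.lookup (g m') k)"
        unfolding sum_subtractf[symmetric]
        by (intro sum.cong) (auto simp: lookup_minus lookup_single when_def algebra_simps)
      also have "(\<Sum>m'\<in>A. if m' = k then c k else 0) =
          (1 / Poly_Mapping.lookup f m) * Poly_Mapping.lookup f k - (if k = m then 1 else 0)"
        using nz by (auto simp: A_def c_def in_keys_iff)
      finally show "Poly_Mapping.lookup (Poly_Mapping.single m 1 - h) k =
          Poly_Mapping.lookup (scalar_mult (1 / Poly_Mapping.lookup f m) f
            - (\<Sum>m'\<in>A. scalar_mult (c m') (Poly_Mapping.single m' 1 - g m'))) k"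
        by (auto simp: h_def lookup_minus sum_negf lookup_sum lookup_single when_def)
    qed
    also have "\<dots> \<in> I"
      by (intro ideal_diff[OF I] ideal_scalar_mult[OF I] ideal_sum[OF I] f g)
    finally have "Poly_Mapping.single m 1 - h \<in> I" .
    moreover have "Poly_Mapping.keys h \<subseteq> standard_monomials I d"
      unfolding h_def using g(1) by (rule keys_linear_combination)
    ultimately show ?thesis by blast
  qed
qed

definition monomial_remainder ::
    "('v::finite, 'k::field) mpoly set \<Rightarrow> ('v \<Rightarrow>\<^sub>0 nat) \<Rightarrow> ('v, 'k) mpoly" where
  "monomial_remainder I m = (SOME g. Poly_Mapping.keys g \<subseteq> standard_monomials I (monom_degree m) \<and>
      Poly_Mapping.single m 1 - g \<in> I)"

lemma monomial_remainder:
  fixes I :: "('v::finite, 'k::field) mpoly set"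
  assumes I: "polynomial_ideal I"
  shows "Poly_Mapping.keys (monomial_remainder I m) \<subseteq> standard_monomials I (monom_degree m)"
    and "Poly_Mapping.single m 1 - monomial_remainder I m \<in> I"
  using someI_ex[OF monomial_normal_form[OF I refl]] unfolding monomial_remainder_def by blast+

text \<open>
  The projection of the forms of degree \<open>d\<close> along \<open>I\<close> onto the span of the standard monomials.
\<close>

definition remainder :: "('v::finite, 'k::field) mpoly set \<Rightarrow> ('v, 'k) mpoly \<Rightarrow> ('v, 'k) mpoly" where
  "remainder I f =
     (\<Sum>m\<in>Poly_Mapping.keys f. scalar_mult (Poly_Mapping.lookup f m) (monomial_remainder I m))"

lemma keys_remainder:
  assumes "polynomial_ideal I" "f \<in> forms d"
  shows "Poly_Mapping.keys (remainder I f) \<subseteq> standard_monomials I d"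
  unfolding remainder_def
  by (rule keys_linear_combination) (use assms monomial_remainder(1) in \<open>fastforce simp: forms_def\<close>)

lemma diff_remainder:
  assumes I: "polynomial_ideal I"
  shows "f - remainder I f \<in> I"
proof -
  have "f - remainder I f = (\<Sum>m\<in>Poly_Mapping.keys f. scalar_mult (Poly_Mapping.lookup f m)
      (Poly_Mapping.single m 1 - monomial_remainder I m))" (is "_ = ?rhs")
  proof (rule poly_mapping_eqI)
    fix k
    have "Poly_Mapping.lookup ?rhs k =
        (\<Sum>m\<in>Poly_Mapping.keys f. Poly_Mapping.lookup f m * (if m = k then 1 else 0)) -
        (\<Sum>m\<in>Poly_Mapping.keys f. Poly_Mapping.lookup f m * Poly_Mapping.lookup (monomial_remainder I m) k)"
      by (simp add: lookup_sum lookup_minus lookup_single when_def algebra_simps sum_subtractf)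
    thus "Poly_Mapping.lookup (f - remainder I f) k = Poly_Mapping.lookup ?rhs k"
      by (auto simp: remainder_def lookup_minus lookup_sum in_keys_iff if_distrib cong: if_cong)
  qed
  also have "\<dots> \<in> I"
    by (intro ideal_sum[OF I] ideal_scalar_mult[OF I] monomial_remainder(2)[OF I])
  finally show ?thesis .
qed

lemma remainder_ideal_eq_0:
  assumes "polynomial_ideal I" "f \<in> forms d" "f \<in> I"
  shows "remainder I f = 0"
proof -
  have "f - (f - remainder I f) \<in> I"
    using assms diff_remainder ideal_diff by blast
  thus ?thesis using standard_monomials_independent[OF _ keys_remainder[OF assms(1,2)]] by simp
qed

lemma monomial_remainder_standard:
  assumes I: "polynomial_ideal I" and "b \<in> standard_monomials I d"
  shows "monomial_remainder I b = Poly_Mapping.single b 1"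
proof -
  have "Poly_Mapping.keys (Poly_Mapping.single b 1 - monomial_remainder I b) \<subseteq> standard_monomials I d"
    using assms monomial_remainder(1)[OF I, of b]
    by (auto simp: in_keys_iff lookup_minus lookup_single when_def standard_monomials_def split: if_splits)
  hence "Poly_Mapping.single b 1 - monomial_remainder I b = 0"
    using standard_monomials_independent monomial_remainder(2)[OF I] by blast
  thus ?thesis by simp
qed

section \<open>Linear dependence modulo an ideal\<close>

text \<open>
  Gaussian elimination: an equation in which the unknown of \<open>a0\<close> occurs is used to eliminate it.
\<close>

lemma homogeneous_system_nontrivial_solution:
  fixes c :: "'a \<Rightarrow> 'b \<Rightarrow> 'k::field"
  assumes "finite B" "finite A" "card B < card A"
  shows "\<exists>x. (\<exists>a\<in>A. x a \<noteq> 0) \<and> (\<forall>b\<in>B. (\<Sum>a\<in>A. x a * c a b) = 0)"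
  using assms
proof (induction B arbitrary: A c)
  case empty
  then obtain a where "a \<in> A" by fastforce
  thus ?case by (intro exI[of _ "\<lambda>_. 1"]) auto
next
  case (insert b B)
  show ?case
  proof (cases "\<forall>a\<in>A. c a b = 0")
    case True
    have "card B < card A" using insert by simp
    then obtain x where "\<exists>a\<in>A. x a \<noteq> 0" "\<forall>b\<in>B. (\<Sum>a\<in>A. x a * c a b) = 0"
      using insert.IH insert.prems by blast
    thus ?thesis using True by (intro exI[of _ x]) auto
  next
    case False
    then obtain a0 where a0: "a0 \<in> A" "c a0 b \<noteq> 0" by blast
    define A' where "A' = A - {a0}"
    define c' where "c' a b' = c a b' - c a b / c a0 b * c a0 b'" for a b'
    have A': "finite A'" "a0 \<notin> A'" "A = insert a0 A'" using a0 insert.prems by (auto simp: A'_def)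
    have "card B < card A'" using insert A' by simp
    then obtain x where x: "\<exists>a\<in>A'. x a \<noteq> 0" "\<forall>b\<in>B. (\<Sum>a\<in>A'. x a * c' a b) = 0"
      using insert.IH[of A' c'] A'(1) by blast
    \<comment> \<open>The value at \<open>a0\<close> solves the equation of \<open>b\<close>.\<close>
    define x' where "x' = x(a0 := - (\<Sum>a\<in>A'. x a * c a b / c a0 b))"
    have x': "(\<Sum>a\<in>A. x' a * c a b') = (\<Sum>a\<in>A'. x a * c' a b')" for b'
    proof -
      have "(\<Sum>a\<in>A. x' a * c a b') = x' a0 * c a0 b' + (\<Sum>a\<in>A'. x a * c a b')"
        using A' by (auto simp: x'_def intro!: sum.cong)
      also have "\<dots> = (\<Sum>a\<in>A'. x a * c' a b')"
        by (simp add: x'_def c'_def sum_distrib_left right_diff_distrib sum_subtractf mult_ac)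
      finally show ?thesis .
    qed
    have "(\<Sum>a\<in>A'. x a * c' a b) = 0"
      using a0 by (simp add: c'_def)
    hence "\<forall>b'\<in>insert b B. (\<Sum>a\<in>A. x' a * c a b') = 0"
      unfolding x' using x(2) by simp
    moreover have "\<exists>a\<in>A. x' a \<noteq> 0" using x(1) A' by (auto simp: x'_def)
    ultimately show ?thesis by blast
  qed
qed

text \<open>
  The remainders of the forms live in a space of dimension \<open>card (standard_monomials I d)\<close>.
\<close>

lemma dependent_modulo_ideal:
  fixes I :: "('v::finite, 'k::field) mpoly set"
  assumes I: "polynomial_ideal I" and "finite A" "\<And>a. a \<in> A \<Longrightarrow> f a \<in> forms d"
    and "card (standard_monomials I d) < card A"
  shows "\<exists>x. (\<exists>a\<in>A. x a \<noteq> 0) \<and> (\<Sum>a\<in>A. scalar_mult (x a) (f a)) \<in> I"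
proof -
  obtain x where x: "\<exists>a\<in>A. x a \<noteq> 0"
      "\<And>b. b \<in> standard_monomials I d \<Longrightarrow> (\<Sum>a\<in>A. x a * Poly_Mapping.lookup (remainder I (f a)) b) = 0"
    using homogeneous_system_nontrivial_solution[OF finite_standard_monomials assms(2,4),
        of "\<lambda>a. Poly_Mapping.lookup (remainder I (f a))"] by blast
  have "(\<Sum>a\<in>A. scalar_mult (x a) (remainder I (f a))) = 0" (is "?g = 0")
  proof (rule poly_mapping_eqI)
    fix k
    have "Poly_Mapping.keys ?g \<subseteq> standard_monomials I d"
      by (intro keys_linear_combination keys_remainder[OF I] assms(3))
    thus "Poly_Mapping.lookup ?g k = Poly_Mapping.lookup 0 k"
      using x(2)[of k] by (auto simp: lookup_sum in_keys_iff subset_iff)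
  qed
  hence "(\<Sum>a\<in>A. scalar_mult (x a) (f a)) = (\<Sum>a\<in>A. scalar_mult (x a) (f a - remainder I (f a)))"
    by (simp add: poly_mapping_eq_iff fun_eq_iff lookup_sum lookup_minus algebra_simps sum_subtractf)
  also have "\<dots> \<in> I"
    by (intro ideal_sum[OF I] ideal_scalar_mult[OF I] diff_remainder[OF I])
  finally show ?thesis using x(1) by blast
qed

section \<open>Graded quotients by module congruences\<close>

abbreviation graded_class ::
    "('v::finite, 'a::comm_semiring_1) mpoly_rel \<Rightarrow> nat \<Rightarrow> ('v, 'a) mpoly \<Rightarrow> ('v, 'a) mpoly set" where
  "graded_class K d f \<equiv> degree_part K d `` {f}"

lemma module_congruenceD:
  assumes "module_congruence K"
  shows "(f, f) \<in> K" and "(f, g) \<in> K \<Longrightarrow> (g, f) \<in> K"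
    and "(f, g) \<in> K \<Longrightarrow> (g, h) \<in> K \<Longrightarrow> (f, h) \<in> K"
    and "(f, g) \<in> K \<Longrightarrow> (f', g') \<in> K \<Longrightarrow> (f + f', g + g') \<in> K"
    and "(f, g) \<in> K \<Longrightarrow> (scalar_mult c f, scalar_mult c g) \<in> K"
  using assms unfolding module_congruence_def equiv_def
  by (auto dest: refl_onD symD transD)

lemma module_congruenceI:
  assumes "\<And>f. (f, f) \<in> K" and "\<And>f g. (f, g) \<in> K \<Longrightarrow> (g, f) \<in> K"
    and "\<And>f g h. (f, g) \<in> K \<Longrightarrow> (g, h) \<in> K \<Longrightarrow> (f, h) \<in> K"
    and "\<And>f g f' g'. (f, g) \<in> K \<Longrightarrow> (f', g') \<in> K \<Longrightarrow> (f + f', g + g') \<in> K"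
    and "\<And>f g c. (f, g) \<in> K \<Longrightarrow> (scalar_mult c f, scalar_mult c g) \<in> K"
  shows "module_congruence K"
proof -
  have "equiv UNIV K"
  proof (rule equivI)
    show "refl_on UNIV K" using assms(1) by (simp add: refl_on_def)
    show "sym K" using assms(2) by (rule symI)
    show "trans K" using assms(3) by (rule transI)
  qed simp
  thus ?thesis unfolding module_congruence_def using assms(4,5) by auto
qed

lemma module_congruence_sum:
  assumes "module_congruence K" "\<And>i. i \<in> A \<Longrightarrow> (f i, g i) \<in> K"
  shows "(sum f A, sum g A) \<in> K"
  using assms(2)
  by (induction A rule: infinite_finite_induct) (auto intro: module_congruenceD[OF assms(1)])

lemma graded_class_eq_iff:
  assumes "module_congruence K" "f \<in> forms d" "g \<in> forms d"
  shows "graded_class K d f = graded_class K d g \<longleftrightarrow> (f, g) \<in> K"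
proof
  assume "graded_class K d f = graded_class K d g"
  moreover have "g \<in> graded_class K d g"
    using assms module_congruenceD(1) by (auto simp: degree_part_def)
  ultimately show "(f, g) \<in> K" by (auto simp: degree_part_def)
next
  assume "(f, g) \<in> K"
  thus "graded_class K d f = graded_class K d g"
    using assms(2,3) module_congruenceD(2)[OF assms(1)] module_congruenceD(3)[OF assms(1)]
    unfolding degree_part_def by blast
qed

lemma carrier_graded_piece: "carrier (graded_piece K d) = graded_class K d ` forms d"
  by (auto simp: graded_piece_def Let_def quotient_def)

lemma graded_piece_ops:
  assumes K: "module_congruence K" and f: "f \<in> forms d"
  shows "zero (graded_piece K d) = graded_class K d 0"
    and "g \<in> forms d \<Longrightarrow> add (graded_piece K d) (graded_class K d f) (graded_class K d g) =
           graded_class K d (f + g)"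
    and "scale (graded_piece K d) c (graded_class K d f) = graded_class K d (scalar_mult c f)"
proof -
  show "zero (graded_piece K d) = graded_class K d 0"
    by (simp add: graded_piece_def Let_def)
  have self: "h \<in> graded_class K d h" if "h \<in> forms d" for h
    using that module_congruenceD(1)[OF K] by (auto simp: degree_part_def)
  {
    assume g: "g \<in> forms d"
    have "graded_class K d (f' + g') = graded_class K d (f + g)"
      if "f' \<in> graded_class K d f" "g' \<in> graded_class K d g" for f' g'
      using that f g by (intro graded_class_eq_iff[OF K, THEN iffD2] add_forms)
        (auto simp: degree_part_def intro: module_congruenceD[OF K])
    hence "(\<Union>f'\<in>graded_class K d f. \<Union>g'\<in>graded_class K d g. graded_class K d (f' + g')) =
        (\<Union>f'\<in>graded_class K d f. \<Union>g'\<in>graded_class K d g. graded_class K d (f + g))"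
      by simp
    also have "\<dots> = graded_class K d (f + g)" using self[OF f] self[OF g] by auto
    finally show "add (graded_piece K d) (graded_class K d f) (graded_class K d g) =
           graded_class K d (f + g)"
      by (simp add: graded_piece_def Let_def)
  }
  have "graded_class K d (scalar_mult c f') = graded_class K d (scalar_mult c f)"
    if "f' \<in> graded_class K d f" for f'
    using that f by (intro graded_class_eq_iff[OF K, THEN iffD2] scalar_mult_forms)
      (auto simp: degree_part_def intro: module_congruenceD[OF K])
  hence "(\<Union>f'\<in>graded_class K d f. graded_class K d (scalar_mult c f')) =
      (\<Union>f'\<in>graded_class K d f. graded_class K d (scalar_mult c f))"
    by simp
  also have "\<dots> = graded_class K d (scalar_mult c f)" using self[OF f] by auto
  finally show "scale (graded_piece K d) c (graded_class K d f) = graded_class K d (scalar_mult c f)"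
    by (simp add: graded_piece_def Let_def)
qed

text \<open>
  The operations of the quotient are defined by unions over classes; this lemma moves the computation to
  representatives.
\<close>

lemma linear_combinations_graded_piece:
  assumes K: "module_congruence K" and "finite A" and f: "\<And>a. a \<in> A \<Longrightarrow> f a \<in> forms d"
  shows "linear_combinations (graded_piece K d) ((\<lambda>a. graded_class K d (f a)) ` A) =
    range (\<lambda>c. graded_class K d (\<Sum>a\<in>A. scalar_mult (c a) (f a)))"
    (is "?L = ?R")
proof (intro equalityI subsetI)
  fix x assume "x \<in> ?L"
  thus "x \<in> ?R"
  proof induction
    case lc_zero
    have "zero (graded_piece K d) = graded_class K d (\<Sum>a\<in>A. scalar_mult 0 (f a))"
      using graded_piece_ops(1)[OF K zero_forms, of d] by simp
    thus ?case by (rule range_eqI[of _ _ "\<lambda>_. 0"])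
  next
    case (lc_add v x k)
    obtain a where a: "a \<in> A" "v = graded_class K d (f a)" using lc_add by blast
    obtain c where c: "x = graded_class K d (\<Sum>a\<in>A. scalar_mult (c a) (f a))" using lc_add by blast
    have "add (graded_piece K d) (scale (graded_piece K d) k v) x =
        graded_class K d (scalar_mult k (f a) + (\<Sum>a\<in>A. scalar_mult (c a) (f a)))"
      unfolding a c graded_piece_ops(3)[OF K f[OF a(1)]]
      by (intro graded_piece_ops(2)[OF K] sum_forms scalar_mult_forms f a)
    also have "scalar_mult k (f a) + (\<Sum>a\<in>A. scalar_mult (c a) (f a)) =
        (\<Sum>a'\<in>A. scalar_mult ((c(a := k + c a)) a') (f a'))"
      using \<open>finite A\<close> a(1)
      by (simp add: sum.remove[of A a] scalar_mult_add_left add.assoc)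
    finally show ?case by (rule range_eqI[of _ _ "c(a := k + c a)"])
  qed
next
  fix x assume "x \<in> ?R"
  then obtain c where x: "x = graded_class K d (\<Sum>a\<in>A. scalar_mult (c a) (f a))" by blast
  have "graded_class K d (\<Sum>a\<in>B. scalar_mult (c a) (f a)) \<in> ?L" if "B \<subseteq> A" for B
    using finite_subset[OF that \<open>finite A\<close>] that
  proof (induction B)
    case empty
    show ?case using lc_zero[of "graded_piece K d"] graded_piece_ops(1)[OF K zero_forms, of d] by simp
  next
    case (insert a B)
    have "graded_class K d (\<Sum>a\<in>insert a B. scalar_mult (c a) (f a)) =
        add (graded_piece K d) (scale (graded_piece K d) (c a) (graded_class K d (f a)))
          (graded_class K d (\<Sum>a\<in>B. scalar_mult (c a) (f a)))"
      using insert f by (subst graded_piece_ops(3)[OF K], simp, subst graded_piece_ops(2)[OF K])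
        (auto intro!: sum_forms scalar_mult_forms)
    also have "\<dots> \<in> ?L"
      using insert by (intro lc_add) auto
    finally show ?case .
  qed
  thus "x \<in> ?L" unfolding x by blast
qed

section \<open>The Hilbert function of an ideal\<close>

lemma module_congruence_ideal:
  assumes I: "polynomial_ideal I"
  shows "module_congruence (ideal_congruence I)"
proof (rule module_congruenceI)
  fix f g h f' g' :: "('a, 'b) mpoly" and c :: 'b
  show "(f, f) \<in> ideal_congruence I" by (simp add: ideal_congruence_def ideal_zero[OF I])
  {
    assume fg: "(f, g) \<in> ideal_congruence I"
    show "(g, f) \<in> ideal_congruence I"
      using ideal_diff[OF I ideal_zero[OF I]] fg by (fastforce simp: ideal_congruence_def)
    show "(f, h) \<in> ideal_congruence I" if "(g, h) \<in> ideal_congruence I"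
      using ideal_add[OF I, of "f - g" "g - h"] fg that by (simp add: ideal_congruence_def)
    show "(f + f', g + g') \<in> ideal_congruence I" if "(f', g') \<in> ideal_congruence I"
      using ideal_add[OF I, of "f - g" "f' - g'"] fg that
      by (simp add: ideal_congruence_def algebra_simps)
    show "(scalar_mult c f, scalar_mult c g) \<in> ideal_congruence I"
      using ideal_scalar_mult[OF I, of "f - g" c] fg
      by (simp add: ideal_congruence_def scalar_mult_eq_times algebra_simps)
  }
qed

lemma SUP_card_eqI:
  assumes "V \<in> F" "card V = n" "\<And>W. W \<in> F \<Longrightarrow> card W \<le> n"
  shows "(SUP V\<in>F. enat (card V)) = enat n"
  by (intro antisym SUP_least SUP_upper2[OF assms(1)]) (use assms in auto)

text \<open>
  Macaulay's theorem: the classes of the standard monomials are linearly independent because no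
  nonzero combination of them is in \<open>I\<close>, and more classes than that are dependent by
  \<open>dependent_modulo_ideal\<close>.
\<close>

lemma ideal_hilbert_function_eq:
  fixes I :: "('v::finite, 'k::field) mpoly set"
  assumes I: "polynomial_ideal I"
  shows "ideal_hilbert_function I d = enat (card (standard_monomials I d))"
proof -
  let ?K = "ideal_congruence I" and ?B = "standard_monomials I d"
  let ?M = "graded_piece ?K d" and ?X = "\<lambda>m. Poly_Mapping.single m (1 :: 'k)"
  note K = module_congruence_ideal[OF I]
  have X: "?X b \<in> forms d" if "b \<in> ?B" for b
    using that by (auto simp: standard_monomials_def intro: single_forms)
  have unit_notin: "?X b - (\<Sum>a\<in>?B - {b}. scalar_mult (c a) (?X a)) \<notin> I" if b: "b \<in> ?B" for b c
  proof
    let ?f = "?X b - (\<Sum>a\<in>?B - {b}. scalar_mult (c a) (?X a))"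
    assume "?f \<in> I"
    moreover have "Poly_Mapping.keys ?f \<subseteq> ?B"
    proof
      fix k assume k: "k \<in> Poly_Mapping.keys ?f"
      have "Poly_Mapping.keys (\<Sum>a\<in>?B - {b}. scalar_mult (c a) (?X a)) \<subseteq> ?B"
        by (rule keys_linear_combination) auto
      thus "k \<in> ?B" using k b by (auto simp: in_keys_iff lookup_minus lookup_single when_def split: if_splits)
    qed
    ultimately have "?f = 0" by (rule standard_monomials_independent)
    moreover have "Poly_Mapping.lookup ?f b = 1"
      by (auto simp: lookup_minus lookup_sum lookup_single when_def intro!: sum.neutral)
    ultimately show False by simp
  qed
  have inj: "inj_on (\<lambda>b. graded_class ?K d (?X b)) ?B"
  proof (rule inj_onI, rule ccontr)
    fix a b assume ab: "a \<in> ?B" "b \<in> ?B" "graded_class ?K d (?X a) = graded_class ?K d (?X b)" "a \<noteq> b"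
    hence "?X a - ?X b \<in> I"
      using graded_class_eq_iff[OF K X X] by (auto simp: ideal_congruence_def)
    moreover have "(\<Sum>e\<in>?B - {a}. scalar_mult (if e = b then 1 else 0) (?X e)) = ?X b"
      using ab finite_standard_monomials[of I d]
      by (simp add: if_distrib[of "\<lambda>c. scalar_mult c _"] cong: if_cong)
    ultimately show False using unit_notin[OF ab(1), of "\<lambda>e. if e = b then 1 else 0"] by simp
  qed
  show ?thesis unfolding ideal_hilbert_function_def vector_space_dim_def
  proof (rule SUP_card_eqI)
    let ?V = "(\<lambda>b. graded_class ?K d (?X b)) ` ?B"
    have "linearly_independent ?M ?V"
      unfolding linearly_independent_def
    proof (intro ballI notI)
      fix v assume "v \<in> ?V" and v: "v \<in> linear_combinations ?M (?V - {v})"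
      then obtain b where b: "b \<in> ?B" "v = graded_class ?K d (?X b)" by blast
      have "?V - {v} = (\<lambda>b. graded_class ?K d (?X b)) ` (?B - {b})"
        using b inj by (auto simp: inj_on_def)
      then obtain c where "v = graded_class ?K d (\<Sum>a\<in>?B - {b}. scalar_mult (c a) (?X a))"
        using v linear_combinations_graded_piece[OF K, of "?B - {b}" ?X d] X
          finite_standard_monomials[of I d] by auto
      hence "(?X b, \<Sum>a\<in>?B - {b}. scalar_mult (c a) (?X a)) \<in> ?K"
        unfolding b(2) by (subst (asm) graded_class_eq_iff[OF K])
          (auto intro!: X b sum_forms scalar_mult_forms)
      thus False using unit_notin[OF b(1)] by (simp add: ideal_congruence_def)
    qed
    thus "?V \<in> {V. finite V \<and> V \<subseteq> carrier ?M \<and> linearly_independent ?M V}"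
      using X finite_standard_monomials[of I d] by (auto simp: carrier_graded_piece)
    show "card ?V = card ?B" using inj by (rule card_image)
  next
    fix V assume "V \<in> {V. finite V \<and> V \<subseteq> carrier ?M \<and> linearly_independent ?M V}"
    hence V: "finite V" "V \<subseteq> carrier ?M" "linearly_independent ?M V" by auto
    show "card V \<le> card ?B"
    proof (rule ccontr)
      assume "\<not> card V \<le> card ?B"
      hence less: "card ?B < card V" by simp
      have "\<forall>v\<in>V. \<exists>f. f \<in> forms d \<and> graded_class ?K d f = v"
        using V(2) by (auto simp: carrier_graded_piece)
      then obtain f where f: "\<And>v. v \<in> V \<Longrightarrow> f v \<in> forms d"
        "\<And>v. v \<in> V \<Longrightarrow> graded_class ?K d (f v) = v" by metis
      obtain x v where v: "v \<in> V" "x v \<noteq> 0" and x: "(\<Sum>v\<in>V. scalar_mult (x v) (f v)) \<in> I"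
        using dependent_modulo_ideal[of I V f d] I V(1) f(1) less by blast
      define g where "g = (\<Sum>w\<in>V - {v}. scalar_mult (- x w / x v) (f w))"
      have g: "g \<in> forms d" unfolding g_def using f by (intro sum_forms scalar_mult_forms) auto
      have "f v - g = scalar_mult (1 / x v) (\<Sum>v\<in>V. scalar_mult (x v) (f v))"
        using v by (intro poly_mapping_eqI)
          (simp add: g_def lookup_minus lookup_add lookup_sum sum.remove[OF V(1) v(1)] sum_distrib_left
            sum_negf field_simps)
      hence "f v - g \<in> I" using ideal_scalar_mult[OF I x] by simp
      hence "v = graded_class ?K d g"
        using f(2)[OF v(1)] graded_class_eq_iff[OF K f(1)[OF v(1)] g]
        by (simp add: ideal_congruence_def)
      also have "\<dots> \<in> linear_combinations ?M ((\<lambda>w. graded_class ?K d (f w)) ` (V - {v}))"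
        unfolding g_def using V(1) f(1) by (subst linear_combinations_graded_piece[OF K]) auto
      also have "(\<lambda>w. graded_class ?K d (f w)) ` (V - {v}) = V - {v}"
        using f(2) by force
      finally show False using V(3) v(1) by (auto simp: linearly_independent_def)
    qed
  qed
qed

section \<open>Valuations and the order of a totally ordered semifield\<close>

lemma valuation_nonzero:
  fixes \<nu> :: "'k::field \<Rightarrow> 's::idempotent_semiring"
  assumes "valuation \<nu>" "a \<noteq> 0"
  shows "\<nu> a \<noteq> 0"
proof
  assume "\<nu> a = 0"
  moreover have "\<nu> a * \<nu> (inverse a) = \<nu> 1"
    using assms by (metis valuation_def right_inverse)
  ultimately show False using assms(1) by (simp add: valuation_def)
qed

lemma valuation_minus:
  assumes "valuation \<nu>"
  shows "\<nu> (- a) = \<nu> a"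
  using assms unfolding valuation_def by (metis mult_1 mult_minus1)

text \<open>
  In the canonical order, the valuation of a sum is at most the sum of the valuations.
\<close>

lemma valuation_sum_le:
  assumes "valuation \<nu>"
  shows "\<nu> (sum a A) + (\<Sum>i\<in>A. \<nu> (a i)) = (\<Sum>i\<in>A. \<nu> (a i))"
proof (induction A rule: infinite_finite_induct)
  case (insert i A)
  let ?T = "\<Sum>i\<in>A. \<nu> (a i)"
  have "\<nu> (a i + sum a A) + (\<nu> (a i) + ?T) =
      (\<nu> (a i + sum a A) + \<nu> (a i) + \<nu> (sum a A)) + ?T"
    using insert.IH by (simp add: add.assoc)
  also have "\<dots> = \<nu> (a i) + (\<nu> (sum a A) + ?T)"
    using assms by (simp add: valuation_def add_ac)
  finally show ?case using insert by simp
qed (use assms in \<open>auto simp: valuation_def\<close>)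

text \<open>
  In a vanishing sum the maximal valuation is attained at least twice: each summand is minus the sum
  of the others, so its valuation is bounded by theirs.
\<close>

lemma valuation_zero_sum:
  assumes \<nu>: "valuation \<nu>" and "finite A" "(\<Sum>i\<in>A. a i) = 0"
  shows "(\<Sum>i\<in>A. \<nu> (a i)) = (\<Sum>i\<in>A - {j}. \<nu> (a i))"
proof (cases "j \<in> A")
  case True
  hence "a j + (\<Sum>i\<in>A - {j}. a i) = 0"
    using assms sum.remove by metis
  hence "a j = - (\<Sum>i\<in>A - {j}. a i)"
    by (simp add: eq_neg_iff_add_eq_0)
  thus ?thesis
    using valuation_sum_le[OF \<nu>, of a "A - {j}"] valuation_minus[OF \<nu>]
    by (simp add: sum.remove[OF assms(2) True])
qed simp

lemma tropical_sum_absorbs: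
  fixes a :: "'i \<Rightarrow> 's::idempotent_semiring"
  assumes "finite A" "i \<in> A"
  shows "sum a A + a i = sum a A"
  using assms by (simp add: sum.remove add_ac add_idempotent flip: add.assoc)

text \<open>
  Over a totally ordered idempotent semifield, addition is the maximum.
\<close>

lemma tropical_sum_attained:
  fixes a :: "'i \<Rightarrow> 's::totally_ordered_idempotent_semifield"
  assumes "finite A" "A \<noteq> {}"
  obtains i where "i \<in> A" "sum a A = a i"
proof -
  have "\<exists>i\<in>A. sum a A = a i"
    using assms
  proof (induction A rule: finite_ne_induct)
    case (insert i A)
    then obtain j where "j \<in> A" "sum a A = a j" by blast
    thus ?case using insert canonical_order_total[of "a i" "a j"]
      by (metis add.commute insert_iff sum.insert)
  qed simp
  thus ?thesis using that by blast
qed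

lemma semifield_mult_left_cancel:
  fixes c :: "'s::totally_ordered_idempotent_semifield"
  assumes "c \<noteq> 0" "c * a = c * b"
  shows "a = b"
proof -
  obtain c' where c': "c * c' = 1" using nonzero_invertible[OF assms(1)] by blast
  have "a = c * c' * a" using c' by simp
  also have "\<dots> = c' * (c * b)" unfolding assms(2)[symmetric] by (simp only: mult_ac)
  also have "\<dots> = c * c' * b" by (simp only: mult_ac)
  also have "\<dots> = b" using c' by simp
  finally show ?thesis .
qed

text \<open>
  If each diagonal entry of a square matrix is nonzero and strictly exceeds the other entries of its
  column, then no nonzero vector \<open>a\<close> satisfies the bend relations of all rows.  Choose \<open>v\<close> such that \<open>a v * p v v\<close> is the
  largest of the weighted diagonal entries.  In row \<open>v\<close> each other term \<open>a w * p v w\<close> is strictly below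
  \<open>a w * p w w\<close> or zero, so \<open>a v * p v v\<close> is the unique largest term there and cannot be omitted.
\<close>

lemma tropical_dominant_matrix_nonsingular:
  fixes p :: "'i \<Rightarrow> 'i \<Rightarrow> 's::totally_ordered_idempotent_semifield"
  assumes V: "finite V" and a: "i \<in> V" "a i \<noteq> 0"
    and diag: "\<And>v. v \<in> V \<Longrightarrow> p v v \<noteq> 0"
    and le: "\<And>v w. v \<in> V \<Longrightarrow> w \<in> V \<Longrightarrow> v \<noteq> w \<Longrightarrow> p w w + p v w = p w w"
    and ne: "\<And>v w. v \<in> V \<Longrightarrow> w \<in> V \<Longrightarrow> v \<noteq> w \<Longrightarrow> p w w \<noteq> p v w"
  shows "\<exists>v\<in>V. (\<Sum>w\<in>V. a w * p v w) \<noteq> (\<Sum>w\<in>V - {v}. a w * p v w)"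
proof -
  obtain v where v: "v \<in> V" and max: "(\<Sum>w\<in>V. a w * p w w) = a v * p v v"
    using tropical_sum_attained[OF V, of "\<lambda>w. a w * p w w"] a(1) by blast
  let ?M = "a v * p v v"
  have max': "?M + a w * p w w = ?M" if "w \<in> V" for w
    using tropical_sum_absorbs[OF V that, of "\<lambda>w. a w * p w w"] by (simp only: max)
  have le': "a w * p w w + a w * p v w = a w * p w w" if "w \<in> V" for w
    using le[OF v that] by (cases "v = w") (auto simp: add_idempotent simp flip: distrib_left)
  have M: "?M \<noteq> 0"
  proof
    assume "?M = 0"
    hence "a i * p i i = 0" using max'[OF a(1)] by simp
    thus False using semifield_mult_left_cancel[OF a(2), of "p i i" 0] diag[OF a(1)] by simp
  qed
  have absorb: "?M + a w * p v w = ?M" if "w \<in> V" for w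
    using max'[OF that] le'[OF that] by (metis add.assoc)
  have "(\<Sum>w\<in>V. a w * p v w) = ?M"
  proof -
    obtain w where w: "w \<in> V" "(\<Sum>w\<in>V. a w * p v w) = a w * p v w"
      using tropical_sum_attained[OF V, of "\<lambda>w. a w * p v w"] v by blast
    have "(\<Sum>w\<in>V. a w * p v w) + ?M = (\<Sum>w\<in>V. a w * p v w)"
      using tropical_sum_absorbs[OF V v, of "\<lambda>w. a w * p v w"] .
    thus ?thesis using absorb[OF w(1)] w(2) by (metis add.commute)
  qed
  moreover have "(\<Sum>w\<in>V - {v}. a w * p v w) \<noteq> ?M"
  proof (cases "V - {v} = {}")
    case False
    then obtain w where w: "w \<in> V - {v}" "(\<Sum>w\<in>V - {v}. a w * p v w) = a w * p v w"
      using tropical_sum_attained[of "V - {v}" "\<lambda>w. a w * p v w"] V by blast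
    show ?thesis
    proof
      assume "(\<Sum>w\<in>V - {v}. a w * p v w) = ?M"
      hence eq: "a w * p v w = ?M" using w(2) by simp
      hence "a w * p w w = a w * p v w"
        using max'[of w] le'[of w] w(1) by (metis Diff_iff add.commute)
      moreover have "a w \<noteq> 0" using eq M by auto
      ultimately have "p w w = p v w" using semifield_mult_left_cancel by blast
      thus False using ne[OF v] w(1) by auto
    qed
  qed (metis M sum.empty)
  ultimately show ?thesis using v by metis
qed

section \<open>Independent sets in the dual of a graded quotient\<close>

lemma linear_combinations_functions:
  assumes "finite V"
    and add: "\<And>x y. add M x y = (\<lambda>p. x p + y p)" and zero: "zero M = (\<lambda>p. 0)"
    and scale: "\<And>c x. scale M c x = (\<lambda>p. c * x p)"
  shows "linear_combinations M V = range (\<lambda>c p. \<Sum>v\<in>V. c v * (v p :: 's::comm_semiring_1))"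
    (is "?L = ?R")
proof (intro equalityI subsetI)
  fix x assume "x \<in> ?L"
  thus "x \<in> ?R"
  proof induction
    case lc_zero
    show ?case unfolding zero by (rule range_eqI[of _ _ "\<lambda>_. 0"]) simp
  next
    case (lc_add v x k)
    then obtain c where c: "x = (\<lambda>p. \<Sum>v\<in>V. c v * v p)" by blast
    have "k * v p + (\<Sum>w\<in>V. c w * w p) = (\<Sum>w\<in>V. (c(v := k + c v)) w * w p)" for p
      using \<open>finite V\<close> lc_add(1) by (simp add: sum.remove[of V v] algebra_simps)
    thus ?case unfolding c add scale by (intro range_eqI[of _ _ "c(v := k + c v)"]) blast
  qed
next
  fix x assume "x \<in> ?R"
  then obtain c where x: "x = (\<lambda>p. \<Sum>v\<in>V. c v * v p)" by blast
  have "(\<lambda>p. \<Sum>v\<in>W. c v * v p) \<in> ?L" if "W \<subseteq> V" for W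
    using finite_subset[OF that \<open>finite V\<close>] that
  proof (induction W)
    case empty
    show ?case using linear_combinations.lc_zero[of M V] by (simp add: zero)
  next
    case (insert v W)
    thus ?case
      using linear_combinations.lc_add[of v V "\<lambda>p. \<Sum>v\<in>W. c v * v p" M "c v"] 
      by (simp add: add scale)
  qed
  thus "x \<in> ?L" unfolding x by blast
qed

lemma linear_combinations_dual:
  assumes "finite V"
  shows "linear_combinations (dual M) V = range (\<lambda>c p. \<Sum>v\<in>V. c v * v p)"
  by (rule linear_combinations_functions[OF assms]) (simp_all add: dual_def)

lemma dualD:
  assumes "\<phi> \<in> carrier (dual M)"
  shows "x \<in> carrier M \<Longrightarrow> y \<in> carrier M \<Longrightarrow> \<phi> (add M x y) = \<phi> x + \<phi> y"
    and "\<phi> (zero M) = 0"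
    and "x \<in> carrier M \<Longrightarrow> \<phi> (scale M c x) = c * \<phi> x"
    and "x \<notin> carrier M \<Longrightarrow> \<phi> x = 0"
  using assms by (simp_all add: dual_def)

lemma dualI:
  assumes "\<And>x y. x \<in> carrier M \<Longrightarrow> y \<in> carrier M \<Longrightarrow> \<phi> (add M x y) = \<phi> x + \<phi> y"
    and "\<phi> (zero M) = 0"
    and "\<And>c x. x \<in> carrier M \<Longrightarrow> \<phi> (scale M c x) = c * \<phi> x"
    and "\<And>x. x \<notin> carrier M \<Longrightarrow> \<phi> x = 0"
  shows "\<phi> \<in> carrier (dual M)"
  using assms by (simp add: dual_def)

lemma linear_combinations_dual_subset_carrier:
  assumes "finite V" "V \<subseteq> carrier (dual M)"
  shows "linear_combinations (dual M) V \<subseteq> carrier (dual M)"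
proof
  fix x assume "x \<in> linear_combinations (dual M) V"
  then obtain c where x: "x = (\<lambda>p. \<Sum>v\<in>V. c v * v p)"
    using linear_combinations_dual[OF assms(1)] by blast
  have V: "v \<in> carrier (dual M)" if "v \<in> V" for v using assms(2) that by blast
  show "x \<in> carrier (dual M)"
  proof (rule dualI)
    fix p q k
    show "x (add M p q) = x p + x q" if "p \<in> carrier M" "q \<in> carrier M"
      unfolding x sum.distrib[symmetric]
    proof (rule sum.cong)
      fix v assume "v \<in> V"
      show "c v * v (add M p q) = c v * v p + c v * v q"
        by (simp only: dualD(1)[OF V[OF \<open>v \<in> V\<close>] that] distrib_left)
    qed simp
    show "x (zero M) = 0"
      unfolding x
    proof (rule sum.neutral, rule ballI)
      fix v assume "v \<in> V"
      show "c v * v (zero M) = 0" by (simp add: dualD(2)[OF V[OF \<open>v \<in> V\<close>]])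
    qed
    show "x (scale M k p) = k * x p" if "p \<in> carrier M"
      unfolding x sum_distrib_left
    proof (rule sum.cong)
      fix v assume "v \<in> V"
      show "c v * v (scale M k p) = k * (c v * v p)"
        by (simp only: dualD(3)[OF V[OF \<open>v \<in> V\<close>] that] mult.left_commute)
    qed simp
    show "x p = 0" if "p \<notin> carrier M"
      unfolding x
    proof (rule sum.neutral, rule ballI)
      fix v assume "v \<in> V"
      show "c v * v p = 0" by (simp add: dualD(4)[OF V[OF \<open>v \<in> V\<close>] that])
    qed
  qed
qed

text \<open>
  An element of the dual is determined by its values on the classes of the monomials of degree \<open>d\<close>.
\<close>

lemma dual_graded_piece_expand:
  fixes \<phi> :: "('v::finite, 's::comm_semiring_1) mpoly set \<Rightarrow> 's"
  assumes K: "module_congruence K" and \<phi>: "\<phi> \<in> carrier (dual (graded_piece K d))"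
    and f: "f \<in> forms d" and A: "finite A" "Poly_Mapping.keys f \<subseteq> A" "\<And>m. m \<in> A \<Longrightarrow> monom_degree m = d"
  shows "\<phi> (graded_class K d f) =
    (\<Sum>m\<in>A. Poly_Mapping.lookup f m * \<phi> (graded_class K d (Poly_Mapping.single m 1)))"
proof -
  note ops = graded_piece_ops[OF K]
  have car: "graded_class K d g \<in> carrier (graded_piece K d)" if "g \<in> forms d" for g
    using that by (auto simp: carrier_graded_piece)
  have zero: "\<phi> (graded_class K d 0) = 0"
    using dualD(2)[OF \<phi>] ops(1)[OF zero_forms, of d] by simp
  have add: "\<phi> (graded_class K d (g + h)) = \<phi> (graded_class K d g) + \<phi> (graded_class K d h)"
    if "g \<in> forms d" "h \<in> forms d" for g h
    using dualD(1)[OF \<phi> car[OF that(1)] car[OF that(2)]] ops(2)[OF that] by simp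
  have scale: "\<phi> (graded_class K d (scalar_mult c g)) = c * \<phi> (graded_class K d g)"
    if "g \<in> forms d" for c g
    using dualD(3)[OF \<phi> car[OF that]] ops(3)[OF that] by simp
  have single_eq: "Poly_Mapping.single m c = scalar_mult c (Poly_Mapping.single m 1)"
    for m :: "'v \<Rightarrow>\<^sub>0 nat" and c :: 's
    by (intro poly_mapping_eqI) (simp add: lookup_single when_def)
  have "\<phi> (graded_class K d (\<Sum>m\<in>A. Poly_Mapping.single m (Poly_Mapping.lookup f m))) =
      (\<Sum>m\<in>A. Poly_Mapping.lookup f m * \<phi> (graded_class K d (Poly_Mapping.single m 1)))"
    using A(1,3)
  proof (induction A)
    case (insert m A)
    have "\<phi> (graded_class K d (Poly_Mapping.single m (Poly_Mapping.lookup f m))) =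
        Poly_Mapping.lookup f m * \<phi> (graded_class K d (Poly_Mapping.single m 1))"
      using insert.prems by (subst single_eq) (auto intro: scale single_forms)
    thus ?case using insert by (simp add: add sum_forms single_forms)
  qed (simp add: zero)
  thus ?thesis by (simp add: sum_single_lookup A)
qed

text \<open>
  Let \<open>x\<close> be a combination of \<open>V\<close> which is not a combination of a proper subset.  Omitting the term of
  \<open>v\<close> changes \<open>x\<close> at some monomial \<open>e v\<close>, so there the term of \<open>v\<close> strictly exceeds the terms of all other
  elements of \<open>V\<close>.  With more elements than standard monomials, some nonzero \<open>f\<close> in \<open>I\<close> is supported on
  the \<open>e v\<close>, and the coefficient valuations of \<open>f\<close> contradict \<open>tropical_dominant_matrix_nonsingular\<close>.
\<close>

lemma trop_dim_dual_le:
  fixes \<nu> :: "'k::field \<Rightarrow> 's::totally_ordered_idempotent_semifield"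
    and I :: "('v::finite, 'k) mpoly set" and K :: "('v, 's) mpoly_rel"
  assumes \<nu>: "valuation \<nu>" and I: "polynomial_ideal I" and K: "module_congruence K"
    and bend: "\<And>f m. f \<in> I \<Longrightarrow>
      (Poly_Mapping.map \<nu> f, delete_term m (Poly_Mapping.map \<nu> f)) \<in> K"
    and V: "finite V" "V \<subseteq> carrier (dual (graded_piece K d))" "\<not> trop_dependent (dual (graded_piece K d)) V"
  shows "card V \<le> card (standard_monomials I d)"
proof (rule ccontr)
  assume "\<not> ?thesis"
  hence less: "card (standard_monomials I d) < card V" by simp
  let ?M = "graded_piece K d" and ?X = "\<lambda>m. graded_class K d (Poly_Mapping.single m 1)"
  have ext: "x = y" if "x \<in> carrier (dual ?M)" "y \<in> carrier (dual ?M)"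
    "\<And>m. monom_degree m = d \<Longrightarrow> x (?X m) = y (?X m)" for x y
  proof
    fix p show "x p = y p"
    proof (cases "p \<in> carrier ?M")
      case True
      then obtain f where f: "f \<in> forms d" "p = graded_class K d f" by (auto simp: carrier_graded_piece)
      have deg: "monom_degree m = d" if "m \<in> Poly_Mapping.keys f" for m
        using f(1) that by (simp add: forms_def)
      show ?thesis unfolding f(2)
        using dual_graded_piece_expand[OF K that(1) f(1) finite_keys order_refl deg]
          dual_graded_piece_expand[OF K that(2) f(1) finite_keys order_refl deg] deg that(3)
        by (simp cong: sum.cong)
    next
      case False
      thus ?thesis using that(1,2) by (simp add: dual_def)
    qed
  qed
  obtain x where x: "x \<in> linear_combinations (dual ?M) V"
    and x_not: "\<And>W. W \<subset> V \<Longrightarrow> x \<notin> linear_combinations (dual ?M) W"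
    using V(3) by (auto simp: trop_dependent_def)
  obtain c where c: "x = (\<lambda>p. \<Sum>v\<in>V. c v * v p)"
    using x linear_combinations_dual[OF V(1)] by blast
  have "\<exists>m. monom_degree m = d \<and> x (?X m) \<noteq> (\<Sum>w\<in>V - {v}. c w * w (?X m))" if v: "v \<in> V" for v
  proof (rule ccontr)
    assume *: "\<not> ?thesis"
    let ?y = "\<lambda>p. \<Sum>w\<in>V - {v}. c w * w p"
    have y: "?y \<in> linear_combinations (dual ?M) (V - {v})"
      using V(1) by (subst linear_combinations_dual) auto
    have "x = ?y"
    proof (rule ext)
      show "x \<in> carrier (dual ?M)"
        using x linear_combinations_dual_subset_carrier[OF V(1,2)] by blast
      show "?y \<in> carrier (dual ?M)"
        using y linear_combinations_dual_subset_carrier[of "V - {v}" ?M] V(1,2) by blast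
    qed (use * in auto)
    thus False using y x_not[of "V - {v}"] v by blast
  qed
  hence ex: "\<forall>v\<in>V. \<exists>m. monom_degree m = d \<and> x (?X m) \<noteq> (\<Sum>w\<in>V - {v}. c w * w (?X m))"
    by simp
  obtain e where
    "\<forall>v\<in>V. monom_degree (e v) = d \<and> x (?X (e v)) \<noteq> (\<Sum>w\<in>V - {v}. c w * w (?X (e v)))"
    using bchoice[OF ex] ..
  hence e: "\<And>v. v \<in> V \<Longrightarrow> monom_degree (e v) = d"
    "\<And>v. v \<in> V \<Longrightarrow> x (?X (e v)) \<noteq> (\<Sum>w\<in>V - {v}. c w * w (?X (e v)))"
    by simp_all
  \<comment> \<open>The square matrix of the terms of \<open>x\<close> at the monomials \<open>e w\<close>.\<close>
  define p where "p v w = c v * v (?X (e w))" for v w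
  have dom: "p w w \<noteq> 0 \<and> (v \<noteq> w \<longrightarrow> p w w + p v w = p w w \<and> p w w \<noteq> p v w)"
    if v: "v \<in> V" and w: "w \<in> V" for v w
  proof -
    \<comment> \<open>Since \<open>r\<close> does not absorb \<open>p w w\<close>, totality of the order makes \<open>p w w\<close> absorb \<open>r\<close>.\<close>
    define r where "r = (\<Sum>u\<in>V - {w}. p u w)"
    have ne: "p w w + r \<noteq> r"
      using e(2)[OF w] unfolding c r_def p_def sum.remove[OF V(1) w] .
    hence eq: "p w w + r = p w w" using canonical_order_total[of "p w w" r] by (metis add.commute)
    have "r + p v w = r" if "v \<noteq> w"
      unfolding r_def using that v V(1) by (intro tropical_sum_absorbs) auto
    hence absorbs: "p w w + p v w = p w w" if "v \<noteq> w"
      using eq that by (metis add.assoc)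
    moreover have "p w w \<noteq> p v w" if "v \<noteq> w"
      using ne \<open>v \<noteq> w \<Longrightarrow> r + p v w = r\<close>[OF that] by (metis add.commute)
    moreover have "p w w \<noteq> 0" using ne by auto
    ultimately show ?thesis by blast
  qed
  have inj: "inj_on e V"
  proof (rule inj_onI, rule ccontr)
    fix v w assume "v \<in> V" "w \<in> V" "e v = e w" "v \<noteq> w"
    thus False using dom[of v w] dom[of w v] by (auto simp: p_def add.commute)
  qed
  have single_forms': "Poly_Mapping.single (e v) (1 :: 'k) \<in> forms d" if "v \<in> V" for v
    using e(1)[OF that] by (rule single_forms)
  obtain a i where i: "i \<in> V" "a i \<noteq> 0"
    and fI: "(\<Sum>v\<in>V. scalar_mult (a v) (Poly_Mapping.single (e v) 1)) \<in> I" (is "?f \<in> I")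
    using dependent_modulo_ideal[of I V "\<lambda>v. Poly_Mapping.single (e v) 1" d] I V(1) single_forms' less
    by blast
  have f_e: "Poly_Mapping.lookup ?f (e v) = a v" if "v \<in> V" for v
  proof -
    have "Poly_Mapping.lookup ?f (e v) = (\<Sum>w\<in>V. if v = w then a w else 0)"
      unfolding lookup_sum using inj that
      by (intro sum.cong) (auto simp: lookup_single when_def inj_on_def)
    thus ?thesis using that V(1) by simp
  qed
  have keys_f: "Poly_Mapping.keys ?f \<subseteq> e ` V"
    by (rule keys_linear_combination) auto
  let ?F = "Poly_Mapping.map \<nu> ?f"
  have lookup_F: "Poly_Mapping.lookup ?F m = \<nu> (Poly_Mapping.lookup ?f m)" for m
    using \<nu> by (simp add: lookup_map_zero valuation_def)
  have keys_F: "Poly_Mapping.keys ?F \<subseteq> e ` V"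
    using keys_f keys_map_zero[of \<nu> ?f] \<nu> by (auto simp only: valuation_def)
  have F_forms: "?F \<in> forms d" using keys_F e(1) by (auto simp: forms_def)
  obtain v where v: "v \<in> V"
    and v_ne: "(\<Sum>w\<in>V. \<nu> (a w) * p v w) \<noteq> (\<Sum>w\<in>V - {v}. \<nu> (a w) * p v w)"
    using tropical_dominant_matrix_nonsingular[of V i "\<lambda>w. \<nu> (a w)" p] V(1) i(1)
      valuation_nonzero[OF \<nu> i(2)] dom by blast
  let ?G = "delete_term (e v) ?F"
  have keys_G: "Poly_Mapping.keys ?G \<subseteq> e ` V"
    unfolding keys_delete_term using keys_F by blast
  have G_forms: "?G \<in> forms d" using keys_G e(1) by (auto simp: forms_def)
  have expand: "c v * v (graded_class K d h) = (\<Sum>w\<in>V. Poly_Mapping.lookup h (e w) * p v w)"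
    if "h \<in> forms d" "Poly_Mapping.keys h \<subseteq> e ` V" for h
  proof -
    have "v (graded_class K d h) = (\<Sum>m\<in>e ` V. Poly_Mapping.lookup h m * v (?X m))"
      using V v that e(1) by (intro dual_graded_piece_expand[OF K]) auto
    thus ?thesis by (simp add: sum.reindex[OF inj] p_def sum_distrib_left mult_ac)
  qed
  have "graded_class K d ?F = graded_class K d ?G"
    using graded_class_eq_iff[OF K F_forms G_forms] bend[OF fI] by blast
  hence "(\<Sum>w\<in>V. Poly_Mapping.lookup ?F (e w) * p v w) = (\<Sum>w\<in>V. Poly_Mapping.lookup ?G (e w) * p v w)"
    using expand[OF F_forms keys_F] expand[OF G_forms keys_G] by simp
  also have "\<dots> = (\<Sum>w\<in>V - {v}. \<nu> (a w) * p v w)"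
    using V(1) v inj by (intro sum.mono_neutral_cong_right)
      (auto simp: lookup_delete_term lookup_F f_e inj_on_def)
  finally show False using v_ne by (simp add: lookup_F f_e cong: sum.cong)
qed

section \<open>Bend congruences of tropicalized ideals\<close>

lemma module_congruence_vimage:
  assumes K: "module_congruence K" and "\<And>f g. h (f + g) = h f + h g"
    and "\<And>c f. h (scalar_mult c f) = scalar_mult c (h f)"
  shows "module_congruence {(f, g). (h f, h g) \<in> K}"
  by (rule module_congruenceI) (auto simp: assms(2,3) intro: module_congruenceD[OF K])

lemma module_congruence_kernel:
  assumes "\<And>f g. h (f + g) = h f + (h g :: 'a::comm_semiring_1)"
    and "\<And>c f. h (scalar_mult c f) = c * h f"
  shows "module_congruence {(f, g). h f = h g}"
  by (rule module_congruenceI) (auto simp: assms)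

lemma delete_term_add: "delete_term m (f + g) = delete_term m f + delete_term m g"
  by (intro poly_mapping_eqI) (simp add: lookup_delete_term lookup_add)

lemma delete_term_scalar_mult: "delete_term m (scalar_mult c f) = scalar_mult c (delete_term m f)"
  by (intro poly_mapping_eqI) (simp add: lookup_delete_term)

lemma module_congruence_bend: "module_congruence (bend_congruence J)"
  unfolding bend_congruence_def
proof (rule module_congruenceI)
  let ?F = "{K. module_congruence K \<and> (\<forall>f\<in>J. bend_relations f \<subseteq> K)}"
  fix f g h f' g' c
  show "(f, f) \<in> \<Inter>?F" by (auto intro: module_congruenceD(1))
  {
    assume fg: "(f, g) \<in> \<Inter>?F"
    show "(g, f) \<in> \<Inter>?F" using fg by (auto intro: module_congruenceD(2))
    show "(f, h) \<in> \<Inter>?F" if "(g, h) \<in> \<Inter>?F"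
    proof
      fix K assume K: "K \<in> ?F"
      hence "(f, g) \<in> K" "(g, h) \<in> K" using fg that by blast+
      thus "(f, h) \<in> K" using K module_congruenceD(3) by blast
    qed
    show "(f + f', g + g') \<in> \<Inter>?F" if "(f', g') \<in> \<Inter>?F"
      using fg that by (auto intro: module_congruenceD(4))
    show "(scalar_mult c f, scalar_mult c g) \<in> \<Inter>?F"
      using fg by (auto intro: module_congruenceD(5))
  }
qed

lemma bend_congruence_least:
  assumes "module_congruence K" "\<And>f m. f \<in> J \<Longrightarrow> (f, delete_term m f) \<in> K"
  shows "bend_congruence J \<subseteq> K"
  using assms unfolding bend_congruence_def bend_relations_def by blast

text \<open>
  Deleting a fixed term is linear, so for a module congruence \<open>K\<close> the polynomials whose bend relations
  are in \<open>K\<close> form a submodule.  Hence it suffices to check the generators \<open>\<nu>(f)\<close> of the tropical ideal.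
  With \<open>bend_congruence_trop_ideal_bend\<close> this characterizes the bend congruence as the least module
  congruence that contains the bend relations of these generators.
\<close>

lemma bend_congruence_trop_ideal_least:
  fixes \<nu> :: "'k::comm_ring_1 \<Rightarrow> 's::idempotent_semiring"
    and I :: "('v::finite, 'k) mpoly set"
  assumes K: "module_congruence K"
    and bend: "\<And>f m. f \<in> I \<Longrightarrow> (Poly_Mapping.map \<nu> f, delete_term m (Poly_Mapping.map \<nu> f)) \<in> K"
  shows "bend_congruence (trop_ideal \<nu> I) \<subseteq> K"
proof (rule bend_congruence_least[OF K])
  have "delete_term m (0 :: ('v, 's) mpoly) = 0" for m :: "'v \<Rightarrow>\<^sub>0 nat"
    by (intro poly_mapping_eqI) (simp add: lookup_delete_term)
  hence "submodule {g. \<forall>m. (g, delete_term m g) \<in> K}"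
    unfolding submodule_def
    by (auto simp: delete_term_add delete_term_scalar_mult intro: module_congruenceD[OF K])
  hence "trop_ideal \<nu> I \<subseteq> {g. \<forall>m. (g, delete_term m g) \<in> K}"
    unfolding trop_ideal_def using bend by blast
  thus "(f, delete_term m f) \<in> K" if "f \<in> trop_ideal \<nu> I" for f m
    using that by blast
qed

lemma bend_congruence_trop_ideal_bend:
  assumes "f \<in> I"
  shows "(Poly_Mapping.map \<nu> f, delete_term m (Poly_Mapping.map \<nu> f)) \<in> bend_congruence (trop_ideal \<nu> I)"
proof (cases "m \<in> Poly_Mapping.keys (Poly_Mapping.map \<nu> f)")
  case True
  have "Poly_Mapping.map \<nu> f \<in> trop_ideal \<nu> I"
    using assms by (auto simp: trop_ideal_def)
  thus ?thesis using True unfolding bend_congruence_def bend_relations_def by blast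
next
  case False
  hence "delete_term m (Poly_Mapping.map \<nu> f) = Poly_Mapping.map \<nu> f"
    by (intro poly_mapping_eqI) (simp add: lookup_delete_term in_keys_iff)
  thus ?thesis using module_congruenceD(1)[OF module_congruence_bend] by simp
qed

lemma times_single_map_valuation:
  fixes \<nu> :: "'k::comm_ring_1 \<Rightarrow> 's::idempotent_semiring"
    and f :: "('v::finite, 'k) mpoly"
  assumes "valuation \<nu>"
  shows "Poly_Mapping.single t 1 * Poly_Mapping.map \<nu> f = Poly_Mapping.map \<nu> (Poly_Mapping.single t 1 * f)"
proof (rule poly_mapping_eqI)
  fix k
  have [simp]: "\<nu> 0 = 0" using assms by (simp add: valuation_def)
  show "Poly_Mapping.lookup (Poly_Mapping.single t 1 * Poly_Mapping.map \<nu> f) k =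
      Poly_Mapping.lookup (Poly_Mapping.map \<nu> (Poly_Mapping.single t 1 * f)) k"
  proof (cases "\<exists>m. k = t + m")
    case True
    thus ?thesis by (auto simp: lookup_single_times(1) lookup_map_zero)
  next
    case False
    thus ?thesis by (simp add: lookup_single_times(2) lookup_map_zero)
  qed
qed

lemma times_single_delete_term:
  "Poly_Mapping.single t 1 * delete_term m f = delete_term (t + m) (Poly_Mapping.single t 1 * f)"
proof (rule poly_mapping_eqI)
  fix k
  show "Poly_Mapping.lookup (Poly_Mapping.single t 1 * delete_term m f) k =
      Poly_Mapping.lookup (delete_term (t + m) (Poly_Mapping.single t 1 * f)) k"
  proof (cases "\<exists>m. k = t + m")
    case True
    thus ?thesis by (auto simp: lookup_single_times(1) lookup_delete_term)
  next
    case False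
    thus ?thesis by (simp add: lookup_single_times(2) lookup_delete_term)
  qed
qed

text \<open>
  Multiplication by a monomial permutes the terms, so it maps the bend relations of \<open>\<nu>(f)\<close> to those of
  the valuation of a multiple of \<open>f\<close>.
\<close>

lemma bend_congruence_trop_ideal_times:
  fixes \<nu> :: "'k::comm_ring_1 \<Rightarrow> 's::idempotent_semiring"
    and I :: "('v::finite, 'k) mpoly set"
  assumes \<nu>: "valuation \<nu>" and I: "polynomial_ideal I"
    and fg: "(f, g) \<in> bend_congruence (trop_ideal \<nu> I)"
  shows "(p * f, p * g) \<in> bend_congruence (trop_ideal \<nu> I)"
proof -
  let ?K = "bend_congruence (trop_ideal \<nu> I)"
  note K = module_congruence_bend[of "trop_ideal \<nu> I"]
  have monom: "(Poly_Mapping.single t 1 * f, Poly_Mapping.single t 1 * g) \<in> ?K" for t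
  proof -
    have "module_congruence {(f, g). (Poly_Mapping.single t 1 * f, Poly_Mapping.single t 1 * g) \<in> ?K}"
      by (rule module_congruence_vimage[OF K])
        (simp_all only: distrib_left scalar_mult_eq_times mult.left_commute)
    hence "?K \<subseteq> {(f, g). (Poly_Mapping.single t 1 * f, Poly_Mapping.single t 1 * g) \<in> ?K}"
      by (rule bend_congruence_trop_ideal_least)
        (auto simp: times_single_delete_term times_single_map_valuation[OF \<nu>]
          intro!: bend_congruence_trop_ideal_bend ideal_times[OF I])
    thus ?thesis using fg by blast
  qed
  have term_times: "Poly_Mapping.single m c * h = scalar_mult c (Poly_Mapping.single m 1 * h)"
    for m c and h :: "('v, 's) mpoly"
    by (simp add: scalar_mult_eq_times mult_single flip: mult.assoc)
  have p: "p * h = (\<Sum>m\<in>Poly_Mapping.keys p. Poly_Mapping.single m (Poly_Mapping.lookup p m) * h)" for h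
    using sum_single_lookup[of "Poly_Mapping.keys p" p] by (simp flip: sum_distrib_right)
  show ?thesis
    unfolding p[of f] p[of g]
    by (intro module_congruence_sum[OF K]) (subst (1 2) term_times, intro module_congruenceD(5)[OF K] monom)
qed

lemma semiring_congruence_bend_trop_ideal:
  assumes \<nu>: "valuation \<nu>" and I: "polynomial_ideal I"
  shows "semiring_congruence (bend_congruence (trop_ideal \<nu> I))"
proof -
  note K = module_congruence_bend[of "trop_ideal \<nu> I"]
  have "(f * f', g * g') \<in> bend_congruence (trop_ideal \<nu> I)"
    if "(f, g) \<in> bend_congruence (trop_ideal \<nu> I)" "(f', g') \<in> bend_congruence (trop_ideal \<nu> I)"
    for f g f' g'
    using bend_congruence_trop_ideal_times[OF \<nu> I that(1), of f']
      bend_congruence_trop_ideal_times[OF \<nu> I that(2), of g]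
    by (auto simp: mult.commute intro: module_congruenceD(3)[OF K])
  thus ?thesis using K unfolding module_congruence_def semiring_congruence_def by auto
qed

lemma bend_congruence_trop_ideal_mono:
  assumes "I \<subseteq> J"
  shows "bend_congruence (trop_ideal \<nu> I) \<subseteq> bend_congruence (trop_ideal \<nu> J)"
  by (rule bend_congruence_trop_ideal_least[OF module_congruence_bend])
    (use assms bend_congruence_trop_ideal_bend in blast)

text \<open>
  Taking the component of degree \<open>d\<close> is linear and commutes with the valuation and with the deletion of
  a term.  It therefore maps the bend relations of \<open>\<nu>(f)\<close> to those of the component of \<open>f\<close>, which is in
  \<open>I\<close> too.
\<close>

lemma bend_congruence_trop_ideal_component:
  fixes \<nu> :: "'k::comm_ring_1 \<Rightarrow> 's::idempotent_semiring"
    and I :: "('v::finite, 'k) mpoly set"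
  assumes \<nu>: "valuation \<nu>" and I: "homogeneous_ideal I"
    and fg: "(f, g) \<in> bend_congruence (trop_ideal \<nu> I)"
  shows "(homogeneous_component d f, homogeneous_component d g)
    \<in> bend_congruence (trop_ideal \<nu> (I \<inter> forms d))"
proof -
  let ?K = "bend_congruence (trop_ideal \<nu> (I \<inter> forms d))"
  let ?h = "homogeneous_component d"
  have "module_congruence {(f, g). (?h f, ?h g) \<in> ?K}"
    by (rule module_congruence_vimage[OF module_congruence_bend])
      (intro poly_mapping_eqI, simp add: lookup_homogeneous_component lookup_add)+
  hence "bend_congruence (trop_ideal \<nu> I) \<subseteq> {(f, g). (?h f, ?h g) \<in> ?K}"
  proof (rule bend_congruence_trop_ideal_least)
    fix f m assume f: "f \<in> I"
    have "?h (Poly_Mapping.map \<nu> f) = Poly_Mapping.map \<nu> (?h f)"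
      using \<nu> by (intro poly_mapping_eqI)
        (simp add: lookup_homogeneous_component lookup_map_zero valuation_def)
    moreover have "?h (delete_term m (Poly_Mapping.map \<nu> f)) = delete_term m (?h (Poly_Mapping.map \<nu> f))"
      by (intro poly_mapping_eqI) (simp add: lookup_homogeneous_component lookup_delete_term)
    moreover have "?h f \<in> I \<inter> forms d"
      using I f by (simp add: homogeneous_ideal_def homogeneous_component_forms)
    ultimately show "(Poly_Mapping.map \<nu> f, delete_term m (Poly_Mapping.map \<nu> f))
        \<in> {(f, g). (?h f, ?h g) \<in> ?K}"
      using bend_congruence_trop_ideal_bend[of "?h f" "I \<inter> forms d"] by simp
  qed
  thus ?thesis using fg by blast
qed

lemma homogeneous_congruence_bend_trop_ideal:
  assumes "valuation \<nu>" "homogeneous_ideal I"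
  shows "homogeneous_congruence (bend_congruence (trop_ideal \<nu> I))"
proof -
  have "semiring_congruence (bend_congruence (trop_ideal \<nu> I))"
    using assms semiring_congruence_bend_trop_ideal homogeneous_ideal_def by blast
  thus ?thesis
    unfolding homogeneous_congruence_def
    using bend_congruence_trop_ideal_component[OF assms]
      bend_congruence_trop_ideal_mono[of "I \<inter> forms _" I \<nu>] by blast
qed

lemma degree_part_bend_trop_ideal:
  assumes "valuation \<nu>" "homogeneous_ideal I"
  shows "degree_part (bend_congruence (trop_ideal \<nu> I)) d =
    degree_part (bend_congruence (trop_ideal \<nu> (I \<inter> forms d))) d"
proof (intro equalityI subsetI)
  fix q assume q: "q \<in> degree_part (bend_congruence (trop_ideal \<nu> I)) d"
  then obtain f g where fg: "q = (f, g)" "f \<in> forms d" "g \<in> forms d"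
    by (auto simp: degree_part_def)
  thus "q \<in> degree_part (bend_congruence (trop_ideal \<nu> (I \<inter> forms d))) d"
    using q bend_congruence_trop_ideal_component[OF assms, of f g d]
    by (simp add: degree_part_def homogeneous_component_id)
qed (use bend_congruence_trop_ideal_mono[of "I \<inter> forms d" I \<nu>] in \<open>auto simp: degree_part_def\<close>)

section \<open>The Hilbert function of a tropicalized ideal\<close>

text \<open>
  The tropicalization of a linear functional: modulo \<open>I\<close>, a form of degree \<open>d\<close> has a coordinate at the
  standard monomial \<open>b\<close>, and the coefficients of this functional are replaced by their valuations.
\<close>

definition coordinate_form ::
    "('k::field \<Rightarrow> 's::comm_semiring_1) \<Rightarrow> ('v::finite, 'k) mpoly set \<Rightarrow> nat \<Rightarrow> ('v \<Rightarrow>\<^sub>0 nat) \<Rightarrow>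
      ('v, 's) mpoly \<Rightarrow> 's" where
  "coordinate_form \<nu> I d b f = (\<Sum>m | monom_degree m = d.
     Poly_Mapping.lookup f m * \<nu> (Poly_Mapping.lookup (monomial_remainder I m) b))"

lemma coordinate_form_linear:
  "coordinate_form \<nu> I d b (f + g) = coordinate_form \<nu> I d b f + coordinate_form \<nu> I d b g"
  "coordinate_form \<nu> I d b (scalar_mult c f) = c * coordinate_form \<nu> I d b f"
  by (simp_all add: coordinate_form_def lookup_add distrib_right sum.distrib sum_distrib_left mult.assoc)

text \<open>
  The coordinate functional vanishes on the component of degree \<open>d\<close> of each \<open>f \<in> I\<close>.  By
  \<open>valuation_zero_sum\<close>, omitting one term of \<open>\<nu>(f)\<close> does not change the value of the tropicalized
  functional.
\<close>

lemma bend_congruence_trop_ideal_coordinate_form: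
  fixes \<nu> :: "'k::field \<Rightarrow> 's::idempotent_semiring"
    and I :: "('v::finite, 'k) mpoly set"
  assumes \<nu>: "valuation \<nu>" and I: "homogeneous_ideal I"
    and fg: "(f, g) \<in> bend_congruence (trop_ideal \<nu> I)"
  shows "coordinate_form \<nu> I d b f = coordinate_form \<nu> I d b g"
proof -
  let ?E = "{m :: 'v \<Rightarrow>\<^sub>0 nat. monom_degree m = d}" and ?\<Phi> = "coordinate_form \<nu> I d b"
  have I': "polynomial_ideal I" using I by (simp add: homogeneous_ideal_def)
  have \<nu>': "\<nu> 0 = 0" "\<nu> (x * y) = \<nu> x * \<nu> y" for x y
    using \<nu> by (simp_all add: valuation_def)
  have finE: "finite ?E" by (rule card_monomials_of_degree)
  have "module_congruence {(f, g). ?\<Phi> f = ?\<Phi> g}"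
    by (rule module_congruence_kernel) (rule coordinate_form_linear)+
  hence "bend_congruence (trop_ideal \<nu> I) \<subseteq> {(f, g). ?\<Phi> f = ?\<Phi> g}"
  proof (rule bend_congruence_trop_ideal_least)
    fix f j assume f: "f \<in> I"
    define a where "a m = Poly_Mapping.lookup f m * Poly_Mapping.lookup (monomial_remainder I m) b" for m
    let ?f = "homogeneous_component d f"
    have "?f \<in> I" using I f by (simp add: homogeneous_ideal_def)
    hence "remainder I ?f = 0"
      by (intro remainder_ideal_eq_0[OF I' homogeneous_component_forms])
    hence "0 = (\<Sum>m\<in>Poly_Mapping.keys ?f. Poly_Mapping.lookup ?f m *
        Poly_Mapping.lookup (monomial_remainder I m) b)"
      by (metis (no_types, lifting) lookup_scalar_mult lookup_sum lookup_zero remainder_def sum.cong)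
    also have "\<dots> = (\<Sum>m\<in>?E. a m)"
      by (intro sum.mono_neutral_cong_left finE)
        (auto simp: in_keys_iff lookup_homogeneous_component a_def split: if_splits)
    finally have zero: "(\<Sum>m\<in>?E. a m) = 0" by simp
    have "?\<Phi> (Poly_Mapping.map \<nu> f) = (\<Sum>m\<in>?E. \<nu> (a m))"
      by (simp add: coordinate_form_def a_def \<nu>' lookup_map_zero)
    also have "\<dots> = (\<Sum>m\<in>?E - {j}. \<nu> (a m))"
      by (rule valuation_zero_sum[OF \<nu> finE zero])
    also have "\<dots> = ?\<Phi> (delete_term j (Poly_Mapping.map \<nu> f))"
      unfolding coordinate_form_def
      by (intro sum.mono_neutral_cong_left finE)
        (auto simp: lookup_delete_term a_def \<nu>' lookup_map_zero)
    finally show "(Poly_Mapping.map \<nu> f, delete_term j (Poly_Mapping.map \<nu> f)) \<in> {(f, g). ?\<Phi> f = ?\<Phi> g}"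
      by simp
  qed
  thus ?thesis using fg by blast
qed

lemma coordinate_form_standard:
  fixes \<nu> :: "'k::field \<Rightarrow> 's::idempotent_semiring"
    and I :: "('v::finite, 'k) mpoly set"
  assumes \<nu>: "valuation \<nu>" and I: "polynomial_ideal I" and "b' \<in> standard_monomials I d"
  shows "coordinate_form \<nu> I d b (Poly_Mapping.single b' 1) = (if b = b' then 1 else 0)"
proof -
  have "coordinate_form \<nu> I d b (Poly_Mapping.single b' 1) =
      (\<Sum>m | monom_degree m = d. if m = b' then \<nu> (Poly_Mapping.lookup (monomial_remainder I b') b) else 0)"
    unfolding coordinate_form_def by (intro sum.cong) (auto simp: lookup_single when_def)
  also have "\<dots> = \<nu> (Poly_Mapping.lookup (Poly_Mapping.single b' 1) b)"
    using assms(3) card_monomials_of_degree(1)[where 'v = 'v, of d]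
    by (simp add: standard_monomials_def monomial_remainder_standard[OF I assms(3)])
  finally show ?thesis using \<nu> by (simp add: lookup_single when_def valuation_def)
qed

lemma descended_form_in_dual:
  fixes K :: "('v::finite, 's::comm_semiring_1) mpoly_rel"
  assumes K: "module_congruence K"
    and h: "\<And>f g. h (f + g) = h f + h g" "\<And>c f. h (scalar_mult c f) = c * h f"
    and desc: "\<And>f g. (f, g) \<in> K \<Longrightarrow> h f = h g"
  obtains \<phi> where "\<phi> \<in> carrier (dual (graded_piece K d))"
    "\<And>f. f \<in> forms d \<Longrightarrow> \<phi> (graded_class K d f) = h f"
proof -
  \<comment> \<open>Functionals in the dual are \<open>0\<close> off the carrier.\<close>
  define \<phi> where "\<phi> A = (if A \<in> carrier (graded_piece K d) then h (SOME f. f \<in> A) else 0)" for A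
  have \<phi>: "\<phi> (graded_class K d f) = h f" if f: "f \<in> forms d" for f
  proof -
    have "f \<in> graded_class K d f"
      using f module_congruenceD(1)[OF K] by (auto simp: degree_part_def)
    hence "(SOME g. g \<in> graded_class K d f) \<in> graded_class K d f" by (rule someI)
    hence "h (SOME g. g \<in> graded_class K d f) = h f"
      using desc by (auto simp: degree_part_def)
    thus ?thesis using f by (auto simp: \<phi>_def carrier_graded_piece)
  qed
  have "\<phi> \<in> carrier (dual (graded_piece K d))"
  proof (rule dualI)
    fix x y c assume "x \<in> carrier (graded_piece K d)"
    then obtain f where f: "f \<in> forms d" "x = graded_class K d f" by (auto simp: carrier_graded_piece)
    show "\<phi> (scale (graded_piece K d) c x) = c * \<phi> x"
      using f by (simp add: graded_piece_ops(3)[OF K f(1)] \<phi> scalar_mult_forms h)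
    assume "y \<in> carrier (graded_piece K d)"
    then obtain g where g: "g \<in> forms d" "y = graded_class K d g" by (auto simp: carrier_graded_piece)
    show "\<phi> (add (graded_piece K d) x y) = \<phi> x + \<phi> y"
      using f g by (simp add: graded_piece_ops(2)[OF K f(1) g(1)] \<phi> add_forms h)
  next
    have "h 0 = 0" using h(2)[of 0 0] by simp
    thus "\<phi> (zero (graded_piece K d)) = 0"
      by (simp add: graded_piece_ops(1)[OF K zero_forms] \<phi>)
  qed (simp add: \<phi>_def)
  thus ?thesis using \<phi> that by blast
qed

text \<open>
  The coordinate forms at the standard monomials are independent elements of the dual, since at the
  class of \<open>b\<close> only the form of \<open>b\<close> is nonzero: their sum is not a combination of a proper subset.
  The matching upper bound is \<open>trop_dim_dual_le\<close>.
\<close>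

lemma congruence_hilbert_function_bend_trop_ideal:
  fixes \<nu> :: "'k::field \<Rightarrow> 's::totally_ordered_idempotent_semifield"
    and I :: "('v::finite, 'k) mpoly set"
  assumes \<nu>: "valuation \<nu>" and I: "homogeneous_ideal I"
  shows "congruence_hilbert_function (bend_congruence (trop_ideal \<nu> I)) d =
    enat (card (standard_monomials I d))"
proof -
  let ?K = "bend_congruence (trop_ideal \<nu> I)" and ?B = "standard_monomials I d"
  let ?M = "graded_piece ?K d" and ?X = "\<lambda>m. Poly_Mapping.single m (1 :: 's)"
  note K = module_congruence_bend[of "trop_ideal \<nu> I"]
  have I': "polynomial_ideal I" using I by (simp add: homogeneous_ideal_def)
  have X: "?X b \<in> forms d" if "b \<in> ?B" for b
    using that by (auto simp: standard_monomials_def intro: single_forms)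
  have "\<forall>b. \<exists>\<phi>. \<phi> \<in> carrier (dual ?M) \<and>
      (\<forall>f\<in>forms d. \<phi> (graded_class ?K d f) = coordinate_form \<nu> I d b f)"
    using descended_form_in_dual[OF K coordinate_form_linear
        bend_congruence_trop_ideal_coordinate_form[OF \<nu> I]] by metis
  then obtain \<phi> where \<phi>: "\<And>b. \<phi> b \<in> carrier (dual ?M)"
    "\<And>b f. f \<in> forms d \<Longrightarrow> \<phi> b (graded_class ?K d f) = coordinate_form \<nu> I d b f"
    by metis
  have \<phi>_B: "\<phi> b (graded_class ?K d (?X b')) = (if b = b' then 1 else 0)" if "b' \<in> ?B" for b b'
    using \<phi>(2)[OF X[OF that]] coordinate_form_standard[OF \<nu> I' that] by simp
  have inj: "inj_on \<phi> ?B"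
  proof (rule inj_onI)
    fix b b' assume "b \<in> ?B" "b' \<in> ?B" "\<phi> b = \<phi> b'"
    thus "b = b'" using \<phi>_B[of b b] \<phi>_B[of b b'] by (metis zero_neq_one)
  qed
  let ?V = "\<phi> ` ?B"
  have finV: "finite ?V" using finite_standard_monomials by (rule finite_imageI)
  show ?thesis unfolding congruence_hilbert_function_def trop_dim_def
  proof (rule SUP_card_eqI)
    have "\<not> trop_dependent (dual ?M) ?V"
    proof
      assume dep: "trop_dependent (dual ?M) ?V"
      define x where "x = (\<lambda>p. \<Sum>v\<in>?V. 1 * v p)"
      have "x \<in> linear_combinations (dual ?M) ?V"
        unfolding linear_combinations_dual[OF finV] x_def by (rule rangeI)
      with dep obtain W where W: "W \<subset> ?V" "x \<in> linear_combinations (dual ?M) W"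
        unfolding trop_dependent_def by meson
      have finW: "finite W" using W(1) finV finite_subset by blast
      obtain c where c: "x = (\<lambda>p. \<Sum>v\<in>W. c v * v p)"
        using W(2) linear_combinations_dual[OF finW] by blast
      obtain b where b: "b \<in> ?B" "\<phi> b \<notin> W" using W(1) by blast
      let ?p = "graded_class ?K d (?X b)"
      have "(\<Sum>v\<in>W. c v * v ?p) = 0"
      proof (rule sum.neutral, rule ballI)
        fix v assume v: "v \<in> W"
        then obtain b' where b': "b' \<in> ?B" "v = \<phi> b'" using W(1) by blast
        hence "b' \<noteq> b" using v b(2) by blast
        thus "c v * v ?p = 0" using \<phi>_B[OF b(1), of b'] b' by simp
      qed
      moreover have "x ?p = (\<Sum>b'\<in>?B. if b' = b then 1 else 0)"
        by (simp add: x_def sum.reindex[OF inj] \<phi>_B[OF b(1)])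
      hence "x ?p = 1" using b(1) finite_standard_monomials[of I d] by simp
      ultimately show False using fun_cong[OF c, of ?p] by simp
    qed
    thus "?V \<in> {V. finite V \<and> V \<subseteq> carrier (dual ?M) \<and> \<not> trop_dependent (dual ?M) V}"
      using finV \<phi>(1) by auto
    show "card ?V = card ?B" using inj by (rule card_image)
  next
    fix V assume "V \<in> {V. finite V \<and> V \<subseteq> carrier (dual ?M) \<and> \<not> trop_dependent (dual ?M) V}"
    thus "card V \<le> card ?B"
      using bend_congruence_trop_ideal_bend
      by (intro trop_dim_dual_le[OF \<nu> I' K]) auto
  qed
qed

section \<open>Hilbert polynomials of closed subschemes\<close>

lemma congruence_hilbert_function_cong:
  "degree_part K d = degree_part K' d \<Longrightarrow>
    congruence_hilbert_function K d = congruence_hilbert_function K' d"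
  by (simp add: congruence_hilbert_function_def graded_piece_def)

lemma ideal_hilbert_function_cong:
  assumes "polynomial_ideal I" "polynomial_ideal J" "I \<inter> forms d = J \<inter> forms d"
  shows "ideal_hilbert_function I d = ideal_hilbert_function J d"
proof -
  have "degree_part (ideal_congruence I) d = degree_part (ideal_congruence J) d"
    using assms(3) diff_forms by (fastforce simp: degree_part_def ideal_congruence_def)
  thus ?thesis by (simp add: ideal_hilbert_function_def graded_piece_def)
qed

lemma eventually_polynomial_unique:
  assumes "eventually_polynomial h P" "eventually_polynomial h Q"
  shows "P = Q"
proof -
  have "\<forall>\<^sub>F d in sequentially. poly (P - Q) (of_nat d) = 0"
    using assms unfolding eventually_polynomial_def
    by eventually_elim auto
  then obtain N where N: "\<And>d. d \<ge> N \<Longrightarrow> poly (P - Q) (of_nat d) = 0"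
    by (auto simp: eventually_sequentially)
  have "infinite (of_nat ` {N..} :: rat set)"
    by (subst finite_image_iff) (auto simp: inj_on_def infinite_Ici)
  moreover have "of_nat ` {N..} \<subseteq> {x. poly (P - Q) x = 0}" using N by auto
  ultimately have "infinite {x. poly (P - Q) x = 0}" using infinite_super by blast
  thus ?thesis using poly_roots_finite[of "P - Q"] by auto
qed

lemma eventually_polynomial_cong:
  assumes "\<forall>\<^sub>F d in sequentially. h d = h' d"
  shows "eventually_polynomial h P \<longleftrightarrow> eventually_polynomial h' P"
  unfolding eventually_polynomial_def
  by (rule eventually_cong[OF assms]) simp

text \<open>
  Two ideals that define \<open>Z\<close> agree in large degrees, hence so do the bend congruences of their
  tropicalizations, by \<open>degree_part_bend_trop_ideal\<close>.
\<close>

lemma Trop_Proj_ideal: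
  fixes \<nu> :: "'k::field \<Rightarrow> 's::idempotent_semiring"
  assumes \<nu>: "valuation \<nu>" and I: "homogeneous_ideal I"
  shows "Trop \<nu> (Proj_ideal I) = Proj_congruence (bend_congruence (trop_ideal \<nu> I))"
proof -
  have "Proj_congruence (bend_congruence (trop_ideal \<nu> I')) =
      Proj_congruence (bend_congruence (trop_ideal \<nu> I))"
    if "I' \<in> Proj_ideal I" for I'
  proof -
    have I': "homogeneous_ideal I'" and ev: "\<forall>\<^sub>F d in sequentially. I' \<inter> forms d = I \<inter> forms d"
      using that by (auto simp: Proj_ideal_def)
    have deg: "\<forall>\<^sub>F d in sequentially. degree_part (bend_congruence (trop_ideal \<nu> I')) d =
        degree_part (bend_congruence (trop_ideal \<nu> I)) d"
      using ev by eventually_elim (metis degree_part_bend_trop_ideal \<nu> I I')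
    have "(\<forall>\<^sub>F d in sequentially. degree_part K d = degree_part (bend_congruence (trop_ideal \<nu> I')) d) \<longleftrightarrow>
        (\<forall>\<^sub>F d in sequentially. degree_part K d = degree_part (bend_congruence (trop_ideal \<nu> I)) d)" for K
      by (rule eventually_cong[OF deg]) simp
    thus ?thesis by (simp add: Proj_congruence_def)
  qed
  moreover have "I \<in> Proj_ideal I" using I by (simp add: Proj_ideal_def)
  ultimately show ?thesis unfolding Trop_def by (intro the_equality) blast+
qed

text \<open>
  Two saturated congruences that define the same closed subscheme contain each other, so the definite
  description in \<open>defining_congruence\<close> denotes.
\<close>

lemma defining_congruence_mem:
  assumes K: "homogeneous_congruence K"
  shows "defining_congruence (Proj_congruence K) \<in> Proj_congruence K"
proof (cases "\<exists>L\<in>Proj_congruence K. saturated L")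
  case True
  then obtain L where L: "L \<in> Proj_congruence K" "saturated L" by blast
  have le: "L1 \<subseteq> L2" if "L1 \<in> Proj_congruence K" "L2 \<in> Proj_congruence K" "saturated L2" for L1 L2
  proof -
    have "\<forall>\<^sub>F d in sequentially. degree_part L1 d = degree_part K d"
      "\<forall>\<^sub>F d in sequentially. degree_part L2 d = degree_part K d"
      using that by (auto simp: Proj_congruence_def)
    hence "\<forall>\<^sub>F d in sequentially. degree_part L1 d = degree_part L2 d"
      by eventually_elim simp
    hence "L1 \<in> Proj_congruence L2" using that by (auto simp: Proj_congruence_def)
    thus ?thesis using that(3) by (auto simp: saturated_def saturation_of_def)
  qed
  have "(THE L. L \<in> Proj_congruence K \<and> saturated L) = L"
    using L le by (intro the_equality) (auto intro!: equalityI)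
  thus ?thesis using L True by (simp add: defining_congruence_def)
next
  case False
  have "K \<in> Proj_congruence K" using K by (simp add: Proj_congruence_def)
  thus ?thesis using False unfolding defining_congruence_def by (auto intro: someI)
qed

theorem theorem2:
  fixes \<nu> :: "'k::field \<Rightarrow> 's::totally_ordered_idempotent_semifield"
    and Z :: "('v::finite, 'k) mpoly set set"
  assumes "valuation \<nu>"
    and "closed_subscheme Z"
  shows "\<exists>P. (\<forall>Q. trop_hilbert_polynomial (Trop \<nu> Z) Q \<longleftrightarrow> Q = P) \<and>
             (\<forall>Q. hilbert_polynomial Z Q \<longleftrightarrow> Q = P)"
proof -
  obtain I where I: "homogeneous_ideal I" and Z: "Z = Proj_ideal I"
    using assms(2) by (auto simp: closed_subscheme_def)
  have I': "polynomial_ideal I" using I by (simp add: homogeneous_ideal_def)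
  let ?h = "\<lambda>d. enat (card (standard_monomials I d))"
  let ?K = "bend_congruence (trop_ideal \<nu> I)"
  obtain P :: "rat poly" where
    "\<forall>\<^sub>F d in sequentially. of_nat (card (standard_monomials I d)) = poly P (of_nat d)"
    using standard_monomials_polynomial[OF I'] by blast
  hence "eventually_polynomial ?h P"
    by (simp add: eventually_polynomial_def eq_commute[of "poly P _"])
  hence P: "eventually_polynomial ?h Q \<longleftrightarrow> Q = P" for Q
    using eventually_polynomial_unique by blast

  have "defining_congruence (Trop \<nu> Z) \<in> Proj_congruence ?K"
    unfolding Z Trop_Proj_ideal[OF assms(1) I]
    by (intro defining_congruence_mem homogeneous_congruence_bend_trop_ideal assms(1) I)
  hence "\<forall>\<^sub>F d in sequentially. degree_part (defining_congruence (Trop \<nu> Z)) d = degree_part ?K d"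
    by (simp add: Proj_congruence_def)
  hence "\<forall>\<^sub>F d in sequentially. congruence_hilbert_function (defining_congruence (Trop \<nu> Z)) d = ?h d"
    by eventually_elim
      (metis congruence_hilbert_function_cong congruence_hilbert_function_bend_trop_ideal assms(1) I)
  hence trop: "trop_hilbert_polynomial (Trop \<nu> Z) Q \<longleftrightarrow> Q = P" for Q
    unfolding trop_hilbert_polynomial_def P[symmetric] by (rule eventually_polynomial_cong)

  have ideal: "eventually_polynomial (ideal_hilbert_function J) Q \<longleftrightarrow> Q = P" if "J \<in> Z" for J Q
    unfolding P[symmetric]
  proof (rule eventually_polynomial_cong)
    have J: "polynomial_ideal J" "\<forall>\<^sub>F d in sequentially. J \<inter> forms d = I \<inter> forms d"
      using that by (auto simp: Z Proj_ideal_def homogeneous_ideal_def)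
    show "\<forall>\<^sub>F d in sequentially. ideal_hilbert_function J d = ?h d"
      using J(2) by eventually_elim
        (metis ideal_hilbert_function_cong ideal_hilbert_function_eq I' J(1))
  qed
  have "I \<in> Z" using I by (simp add: Z Proj_ideal_def)
  hence "hilbert_polynomial Z Q \<longleftrightarrow> Q = P" for Q
    unfolding hilbert_polynomial_def using ideal by blast
  thus ?thesis using trop by blast
qed

end
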